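(* Let $\Sigma\subseteq\mathbb{C}$ be a nonempty finite set, let $L$ be a bounded band operator on $\ell^2(\mathbb{Z})$ with $LS=SL$, and let $\gamma\in\mathbb{Z}$. For $u\in\Sigma^{\mathbb{N}}$ let $H(u)^+$ be the half-axis generalized Schrödinger operator on $\ell^2(\mathbb{N})$ (defined in the context). Let $b,b_1,b_2,\ldots\in\Sigma^{\mathbb{N}}$, and put $A^+:=H(b)^+$ and $A_m^+:=H(b_m)^+$. Suppose that \[ \forall N\in\mathbb{N}\ \exists m_0\in\mathbb{N}\ \forall m\ge m_0:\quad \mathcal{W}_N(b_m)=\mathcal{W}_N(b), \] and that $b_m\to b$ pointwise. Then, for all $\lambda\in\mathbb{C}$ and $\varepsilon>0$, as $m\to\infty$, \[ \|(A_m^+-\lambda)^{-1}\|\to\|(A^+-\lambda)^{-1}\|\qquad\text{and}\qquad\sigma_\varepsilon(A_m^+)\to\sigma_\varepsilon(A^+)\ \text{in the Hausdorff distance.} \] If, in addition, all $A_m^+$ and $A^+$ are normal, then also $\sigma(A_m^+)\to\sigma(A^+)$ in the Hausdorff distance.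
   Context: $\mathbb{N}=\{1,2,3,\dots\}$. $S$ is the shift on $\ell^2(\mathbb{Z})$, $(Sx)_n=x_{n-1}$; $M_u$ is multiplication by $u$. A band operator on $\ell^2(\mathbb{Z})$ is a finite sum $\sum_{k=-w}^{w}M_{a^{(k)}}S^k$ with $a^{(k)}\in\ell^\infty(\mathbb{Z})$. For an operator $A$ on $\ell^2(\mathbb{Z})$ with matrix $(A_{ij})_{i,j\in\mathbb{Z}}$, its compression $A^+$ is the operator on $\ell^2(\mathbb{N})$ with matrix $(A_{ij})_{i,j\in\mathbb{N}}$. For $u\in\Sigma^{\mathbb{N}}$, $H(u)^+$ denotes the compression to $\mathbb{N}$ of $L+S^\gamma M_{\tilde u}$, where $\tilde u\in\Sigma^{\mathbb{Z}}$ is any extension of $u$ (the compression does not depend on the choice of extension). For $u\in\Sigma^{\mathbb{N}}$ and $N\in\mathbb{N}$, $\mathcal{W}_N(u)$ is the set of subwords $(u(k),\dots,u(k+N-1))$, $k\in\mathbb{N}$. $\sigma(T)$ is the spectrum; $\sigma_\varepsilon(T):=\{\lambda:\|(T-\lambda)^{-1}\|>1/\varepsilon\}$ with $\|B^{-1}\|:=\infty$ if $B$ is not invertible. *)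

theory Defs
  imports "HOL-Analysis.Analysis"
begin

definition l2Z :: "(int \<Rightarrow> complex) set" where
  "l2Z = {x. (\<lambda>n. (cmod (x n))^2) summable_on UNIV}"

(* l^2(N), N = {1,2,...}, identified with the subspace of l^2(Z) of sequences vanishing on n \<le> 0 *)
definition l2N :: "(int \<Rightarrow> complex) set" where
  "l2N = {x \<in> l2Z. \<forall>n\<le>0. x n = 0}"

definition l2norm :: "(int \<Rightarrow> complex) \<Rightarrow> real" where
  "l2norm x = sqrt (infsum (\<lambda>n. (cmod (x n))^2) UNIV)"

definition l2inner :: "(int \<Rightarrow> complex) \<Rightarrow> (int \<Rightarrow> complex) \<Rightarrow> complex" where
  "l2inner x y = infsum (\<lambda>n. x n * cnj (y n)) UNIV"

definition shift :: "(int \<Rightarrow> complex) \<Rightarrow> (int \<Rightarrow> complex)" where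
  "shift x = (\<lambda>n. x (n - 1))"

definition shift_pow :: "int \<Rightarrow> (int \<Rightarrow> complex) \<Rightarrow> (int \<Rightarrow> complex)" where
  "shift_pow k x = (\<lambda>n. x (n - k))"

definition mult_op :: "(int \<Rightarrow> complex) \<Rightarrow> (int \<Rightarrow> complex) \<Rightarrow> (int \<Rightarrow> complex)" where
  "mult_op u x = (\<lambda>n. u n * x n)"

definition band_op :: "nat \<Rightarrow> (int \<Rightarrow> int \<Rightarrow> complex) \<Rightarrow> (int \<Rightarrow> complex) \<Rightarrow> (int \<Rightarrow> complex)" where
  "band_op w a x = (\<lambda>n. \<Sum>k\<in>{- int w..int w}. mult_op (a k) (shift_pow k x) n)"

definition is_band_op :: "((int \<Rightarrow> complex) \<Rightarrow> (int \<Rightarrow> complex)) \<Rightarrow> bool" where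
  "is_band_op L \<longleftrightarrow> (\<exists>w a. (\<forall>k. bounded (range (a k))) \<and> L = band_op w a)"

(* an extension of u \<in> Sigma^N to Z (the compression does not depend on the choice) *)
definition ext_seq :: "(nat \<Rightarrow> complex) \<Rightarrow> (int \<Rightarrow> complex)" where
  "ext_seq u = (\<lambda>n. if n \<ge> 1 then u (nat n) else 0)"

definition H_op :: "((int \<Rightarrow> complex) \<Rightarrow> (int \<Rightarrow> complex)) \<Rightarrow> int \<Rightarrow> (int \<Rightarrow> complex)
     \<Rightarrow> (int \<Rightarrow> complex) \<Rightarrow> (int \<Rightarrow> complex)" where
  "H_op L \<gamma> ut x = (\<lambda>n. L x n + shift_pow \<gamma> (mult_op ut x) n)"

definition projN :: "(int \<Rightarrow> complex) \<Rightarrow> (int \<Rightarrow> complex)" where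
  "projN x = (\<lambda>n. if n \<ge> 1 then x n else 0)"

definition compress :: "((int \<Rightarrow> complex) \<Rightarrow> (int \<Rightarrow> complex)) \<Rightarrow> (int \<Rightarrow> complex) \<Rightarrow> (int \<Rightarrow> complex)" where
  "compress A x = projN (A (projN x))"

definition Hplus :: "((int \<Rightarrow> complex) \<Rightarrow> (int \<Rightarrow> complex)) \<Rightarrow> int \<Rightarrow> (nat \<Rightarrow> complex)
     \<Rightarrow> (int \<Rightarrow> complex) \<Rightarrow> (int \<Rightarrow> complex)" where
  "Hplus L \<gamma> u = compress (H_op L \<gamma> (ext_seq u))"

definition shifted :: "((int \<Rightarrow> complex) \<Rightarrow> (int \<Rightarrow> complex)) \<Rightarrow> complex \<Rightarrow> (int \<Rightarrow> complex) \<Rightarrow> (int \<Rightarrow> complex)" where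
  "shifted T z x = (\<lambda>n. T x n - z * x n)"

definition invertibleN :: "((int \<Rightarrow> complex) \<Rightarrow> (int \<Rightarrow> complex)) \<Rightarrow> bool" where
  "invertibleN B \<longleftrightarrow> bij_betw B l2N l2N \<and>
     (\<exists>C. \<forall>y\<in>l2N. l2norm (inv_into l2N B y) \<le> C * l2norm y)"

definition inv_norm :: "((int \<Rightarrow> complex) \<Rightarrow> (int \<Rightarrow> complex)) \<Rightarrow> ereal" where
  "inv_norm B = (if invertibleN B
      then Sup {ereal (l2norm (inv_into l2N B y)) | y. y \<in> l2N \<and> l2norm y \<le> 1}
      else \<infinity>)"

definition resolvent_norm :: "((int \<Rightarrow> complex) \<Rightarrow> (int \<Rightarrow> complex)) \<Rightarrow> complex \<Rightarrow> ereal" where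
  "resolvent_norm T z = inv_norm (shifted T z)"

definition spectrumN :: "((int \<Rightarrow> complex) \<Rightarrow> (int \<Rightarrow> complex)) \<Rightarrow> complex set" where
  "spectrumN T = {z. \<not> invertibleN (shifted T z)}"

definition pseudospectrumN :: "((int \<Rightarrow> complex) \<Rightarrow> (int \<Rightarrow> complex)) \<Rightarrow> real \<Rightarrow> complex set" where
  "pseudospectrumN T \<epsilon> = {z. resolvent_norm T z > ereal (1 / \<epsilon>)}"

definition normalN :: "((int \<Rightarrow> complex) \<Rightarrow> (int \<Rightarrow> complex)) \<Rightarrow> bool" where
  "normalN T \<longleftrightarrow> (\<exists>T'. (\<forall>x\<in>l2N. T' x \<in> l2N) \<and>
      (\<forall>x\<in>l2N. \<forall>y\<in>l2N. l2inner (T x) y = l2inner x (T' y)) \<and>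
      (\<forall>x\<in>l2N. T (T' x) = T' (T x)))"

definition hausdistE :: "complex set \<Rightarrow> complex set \<Rightarrow> ereal" where
  "hausdistE A B = (if A = {} \<and> B = {} then 0 else if A = {} \<or> B = {} then \<infinity>
     else max (SUP x\<in>A. ereal (infdist x B)) (SUP y\<in>B. ereal (infdist y A)))"

definition words :: "nat \<Rightarrow> (nat \<Rightarrow> complex) \<Rightarrow> complex list set" where
  "words N u = {map u [k..<k+N] | k. 1 \<le> k}"

end

theory Submission
  imports Defs
begin

text \<open>
  Let \<open>\<mu>(z)\<close> be the largest \<open>c\<close> such that both \<open>A - z\<close> and its adjoint are bounded below by \<open>c\<close>
  on \<open>l\<^sup>2(N)\<close>; then the resolvent norm is \<open>1 / \<mu>(z)\<close>. For a band matrix, lower bounds can be tested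
  on vectors supported in windows of length \<open>D\<close>, with a loss of order \<open>1 / sqrt D\<close> that depends
  only on the off-diagonal entries and hence not on \<open>z\<close>. Windows near the boundary are governed
  by the pointwise convergence \<open>b_m \<rightarrow> b\<close>, all others by the subwords of a fixed length. So
  \<open>\<mu>_m \<rightarrow> \<mu>\<close> uniformly on the complex plane.

  For the set convergence one needs that \<open>{\<mu> < \<epsilon> + \<delta>}\<close> stays close to \<open>{\<mu> < \<epsilon>}\<close>. If \<open>B = A - z\<close>
  is invertible and \<open>x\<close> nearly minimizes \<open>\<parallel>B x\<parallel> / \<parallel>x\<parallel>\<close>, put \<open>v = x + \<omega> B\<^sup>-\<^sup>1 x + \<omega>\<^sup>2 B\<^sup>-\<^sup>2 x\<close> with
  \<open>\<bar>\<omega>\<bar> = \<rho>\<close>. Then \<open>(B - \<omega>) v = B x - \<omega>\<^sup>3 B\<^sup>-\<^sup>2 x\<close>, while averaging \<open>\<parallel>v\<parallel>\<^sup>2\<close> over four rotations of \<open>\<omega>\<close>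
  gives at least \<open>\<parallel>x\<parallel>\<^sup>2 + \<rho>\<^sup>2 \<parallel>B\<^sup>-\<^sup>1 x\<parallel>\<^sup>2\<close>: the gain is quadratic in \<open>\<rho>\<close> and the error cubic, so \<open>\<mu>\<close>
  strictly decreases within distance \<open>\<rho>\<close>. If \<open>A\<close> is normal, \<open>\<parallel>B\<^sup>-\<^sup>1 x\<parallel>\<close> is about \<open>\<parallel>x\<parallel> / \<mu>(z)\<close>, the
  relative decrease is uniform at scale \<open>\<rho> = \<mu>(z) / 4\<close>, and \<open>dist(z, spectrum) \<le> 50 \<mu>(z)\<close> follows.
\<close>

section \<open>The sequence space\<close>

lemma l2norm_nonneg [simp]: "0 \<le> l2norm x"
  by (simp add: l2norm_def infsum_nonneg)

lemma L2_set_le_l2norm: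
  assumes "x \<in> l2Z"
  shows "L2_set (\<lambda>n. cmod (x n)) F \<le> l2norm x"
proof (cases "finite F")
  case True
  with assms show ?thesis
    unfolding L2_set_def l2norm_def l2Z_def
    by (intro real_sqrt_le_mono finite_sum_le_infsum) auto
qed simp

text \<open>Membership and the norm bound come together from bounds on finite sections, so
  inequalities for \<open>L2_set\<close>, Minkowski's among them, carry over to the whole line
  without a separate limit argument.\<close>

lemma l2_boundedI:
  assumes C: "0 \<le> C" and le: "\<And>F. finite F \<Longrightarrow> L2_set (\<lambda>n. cmod (x n)) F \<le> C"
  shows "x \<in> l2Z" and "l2norm x \<le> C"
proof -
  have sq: "(\<Sum>n\<in>F. (cmod (x n))^2) \<le> C^2" if "finite F" for F
    using le[OF that] C unfolding L2_set_def
    by (metis real_sqrt_le_iff real_sqrt_abs abs_of_nonneg)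
  show x: "x \<in> l2Z"
    unfolding l2Z_def mem_Collect_eq
    by (rule nonneg_bdd_above_summable_on) (auto simp: bdd_above_def intro: sq)
  have "infsum (\<lambda>n. (cmod (x n))^2) UNIV \<le> C^2"
    using x by (intro infsum_le_finite_sums) (auto simp: l2Z_def intro: sq)
  then show "l2norm x \<le> C"
    unfolding l2norm_def using C by (simp add: real_le_lsqrt)
qed

lemma l2norm_sq: "(l2norm x)^2 = (\<Sum>\<^sub>\<infinity>n. (cmod (x n))^2)"
  by (simp add: l2norm_def infsum_nonneg)

lemma l2norm_finite:
  assumes "finite F" and "\<And>n. n \<notin> F \<Longrightarrow> x n = 0"
  shows "l2norm x = L2_set (\<lambda>n. cmod (x n)) F"
proof -
  have "(\<Sum>\<^sub>\<infinity>n. (cmod (x n))^2) = (\<Sum>\<^sub>\<infinity>n\<in>F. (cmod (x n))^2)"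
    by (rule infsum_cong_neutral) (use assms in auto)
  then show ?thesis
    using assms by (simp add: l2norm_def L2_set_def)
qed

lemma l2norm_zero [simp]: "l2norm (\<lambda>_. 0) = 0"
  by (simp add: l2norm_def)

lemma l2Z_finite:
  assumes "finite F" and "\<And>n. n \<notin> F \<Longrightarrow> x n = 0"
  shows "x \<in> l2Z"
proof -
  have "(\<lambda>n. (cmod (x n))^2) summable_on UNIV \<longleftrightarrow> (\<lambda>n. (cmod (x n))^2) summable_on F"
    by (rule summable_on_cong_neutral) (use assms in auto)
  then show ?thesis
    using assms by (simp add: l2Z_def)
qed

lemma l2_dominated:
  assumes "x \<in> l2Z" and "0 \<le> \<alpha>" and "\<And>n. cmod (y n) \<le> \<alpha> * cmod (x (n + d))"
  shows "y \<in> l2Z" and "l2norm y \<le> \<alpha> * l2norm x"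
proof -
  have *: "L2_set (\<lambda>n. cmod (y n)) F \<le> \<alpha> * l2norm x" if "finite F" for F
  proof -
    have "L2_set (\<lambda>n. cmod (y n)) F \<le> L2_set (\<lambda>n. \<alpha> * cmod (x (n + d))) F"
      by (rule L2_set_mono) (use assms in auto)
    also have "\<dots> = \<alpha> * L2_set (\<lambda>n. cmod (x (n + d))) F"
      by (simp add: L2_set_right_distrib assms)
    also have "L2_set (\<lambda>n. cmod (x (n + d))) F = L2_set (\<lambda>n. cmod (x n)) ((\<lambda>n. n + d) ` F)"
      by (simp add: L2_set_def sum.reindex)
    also have "\<alpha> * \<dots> \<le> \<alpha> * l2norm x"
      by (intro mult_left_mono L2_set_le_l2norm assms)
    finally show ?thesis .
  qed
  have "0 \<le> \<alpha> * l2norm x" using assms(2) by simp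
  from l2_boundedI[OF this *] show "y \<in> l2Z" and "l2norm y \<le> \<alpha> * l2norm x"
    by auto
qed

lemma l2_add:
  assumes "x \<in> l2Z" "y \<in> l2Z"
  shows "(\<lambda>n. x n + y n) \<in> l2Z" and "l2norm (\<lambda>n. x n + y n) \<le> l2norm x + l2norm y"
proof -
  have *: "L2_set (\<lambda>n. cmod (x n + y n)) F \<le> l2norm x + l2norm y" for F
  proof -
    have "L2_set (\<lambda>n. cmod (x n + y n)) F \<le> L2_set (\<lambda>n. cmod (x n) + cmod (y n)) F"
      by (rule L2_set_mono) (auto intro: norm_triangle_ineq)
    also have "\<dots> \<le> L2_set (\<lambda>n. cmod (x n)) F + L2_set (\<lambda>n. cmod (y n)) F"
      by (rule L2_set_triangle_ineq)
    also have "\<dots> \<le> l2norm x + l2norm y"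
      by (intro add_mono L2_set_le_l2norm assms)
    finally show ?thesis .
  qed
  have "0 \<le> l2norm x + l2norm y" by simp
  from l2_boundedI[OF this *] show "(\<lambda>n. x n + y n) \<in> l2Z"
    and "l2norm (\<lambda>n. x n + y n) \<le> l2norm x + l2norm y" by auto
qed

lemma l2norm_scale: "l2norm (\<lambda>n. a * x n) = cmod a * l2norm x"
proof -
  have "(\<Sum>\<^sub>\<infinity>n. (cmod (a * x n))^2) = (cmod a)^2 * (\<Sum>\<^sub>\<infinity>n. (cmod (x n))^2)"
    by (simp add: norm_mult power_mult_distrib infsum_cmult_right')
  then show ?thesis
    by (simp add: l2norm_def real_sqrt_mult)
qed

lemma l2_scale: "x \<in> l2Z \<Longrightarrow> (\<lambda>n. a * x n) \<in> l2Z"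
  by (rule l2_dominated(1)[where \<alpha> = "cmod a" and d = 0]) (auto simp: norm_mult)

lemma l2_diff:
  assumes "x \<in> l2Z" "y \<in> l2Z"
  shows "(\<lambda>n. x n - y n) \<in> l2Z" and "l2norm (\<lambda>n. x n - y n) \<le> l2norm x + l2norm y"
  using l2_add[OF assms(1) l2_scale[OF assms(2), of "-1"]] l2norm_scale[of "-1" y] by auto

lemma l2_sum:
  assumes "finite D" "\<And>d. d \<in> D \<Longrightarrow> f d \<in> l2Z"
  shows "(\<lambda>n. \<Sum>d\<in>D. f d n) \<in> l2Z \<and> l2norm (\<lambda>n. \<Sum>d\<in>D. f d n) \<le> (\<Sum>d\<in>D. l2norm (f d))"
  using assms
proof (induction D rule: finite_induct)
  case empty
  then show ?case using l2Z_finite[of "{}" "\<lambda>_. 0"] l2norm_finite[of "{}" "\<lambda>_. 0"] by simp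
next
  case (insert d D)
  then show ?case
    using l2_add[of "f d" "\<lambda>n. \<Sum>d\<in>D. f d n"] by auto
qed

lemma l2N_l2Z: "x \<in> l2N \<Longrightarrow> x \<in> l2Z"
  and l2N_nonpos: "x \<in> l2N \<Longrightarrow> n \<le> 0 \<Longrightarrow> x n = 0"
  by (auto simp: l2N_def)

lemma l2N_add: "x \<in> l2N \<Longrightarrow> y \<in> l2N \<Longrightarrow> (\<lambda>n. x n + y n) \<in> l2N"
  and l2N_diff: "x \<in> l2N \<Longrightarrow> y \<in> l2N \<Longrightarrow> (\<lambda>n. x n - y n) \<in> l2N"
  and l2N_scale: "x \<in> l2N \<Longrightarrow> (\<lambda>n. a * x n) \<in> l2N"
  by (auto simp: l2N_def l2_add l2_diff l2_scale)

lemma l2N_finite: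
  assumes "finite F" and "\<And>n. n \<notin> F \<Longrightarrow> x n = 0" and "\<And>n. n \<in> F \<Longrightarrow> 1 \<le> n"
  shows "x \<in> l2N"
  using l2Z_finite[OF assms(1,2)] assms(2,3) by (force simp: l2N_def)

lemma cmod_le_l2norm: "x \<in> l2Z \<Longrightarrow> cmod (x n) \<le> l2norm x"
  using L2_set_le_l2norm[of x "{n}"] by (simp add: L2_set_def)

lemma l2norm_eq_0: "x \<in> l2Z \<Longrightarrow> l2norm x = 0 \<Longrightarrow> x = (\<lambda>_. 0)"
  using cmod_le_l2norm[of x] by (intro ext) simp

lemma l2norm_pos: "x \<in> l2Z \<Longrightarrow> x \<noteq> (\<lambda>_. 0) \<Longrightarrow> 0 < l2norm x"
  using l2norm_eq_0 l2norm_nonneg by (metis less_eq_real_def)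

section \<open>The inner product and the Cauchy-Schwarz inequality\<close>

lemma l2_prod_summable:
  assumes "x \<in> l2Z" "y \<in> l2Z"
  shows "(\<lambda>n. x n * cnj (y n)) summable_on UNIV"
    and "(\<lambda>n. cmod (x n * cnj (y n))) summable_on UNIV"
proof -
  show *: "(\<lambda>n. cmod (x n * cnj (y n))) summable_on UNIV"
  proof (rule summable_on_comparison_test)
    show "(\<lambda>n. (cmod (x n))^2 + (cmod (y n))^2) summable_on UNIV"
      using assms by (auto simp: l2Z_def intro: summable_on_add)
    show "cmod (x n * cnj (y n)) \<le> (cmod (x n))^2 + (cmod (y n))^2" for n
    proof -
      have "2 * (cmod (x n) * cmod (y n)) \<le> (cmod (x n))^2 + (cmod (y n))^2"
        using sum_squares_bound[of "cmod (x n)" "cmod (y n)"] by (simp add: mult.assoc)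
      moreover have "0 \<le> cmod (x n) * cmod (y n)" by simp
      ultimately show ?thesis
        unfolding norm_mult complex_mod_cnj by linarith
    qed
  qed auto
  then show "(\<lambda>n. x n * cnj (y n)) summable_on UNIV"
    by (rule abs_summable_summable)
qed

lemma l2inner_self:
  assumes "x \<in> l2Z"
  shows "l2inner x x = of_real ((l2norm x)^2)"
proof -
  have "((\<lambda>n. complex_of_real ((cmod (x n))^2)) has_sum of_real ((l2norm x)^2)) UNIV"
    using assms unfolding l2norm_sq l2Z_def by (intro has_sum_of_real has_sum_infsum) auto
  then show ?thesis
    unfolding l2inner_def by (simp only: complex_norm_square infsumI)
qed

lemma l2inner_cnj: "l2inner y x = cnj (l2inner x y)"
  unfolding l2inner_def by (simp add: infsum_cnj[symmetric] mult.commute del: infsum_cnj)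

lemma l2inner_add_left:
  assumes "x \<in> l2Z" "y \<in> l2Z" "z \<in> l2Z"
  shows "l2inner (\<lambda>n. x n + y n) z = l2inner x z + l2inner y z"
  unfolding l2inner_def using assms
  by (simp add: distrib_right infsum_add l2_prod_summable)

lemma l2inner_scale_left: "l2inner (\<lambda>n. a * x n) z = a * l2inner x z"
  unfolding l2inner_def by (simp add: mult.assoc infsum_cmult_right')

lemma l2inner_diff_left:
  assumes "x \<in> l2Z" "y \<in> l2Z" "z \<in> l2Z"
  shows "l2inner (\<lambda>n. x n - y n) z = l2inner x z - l2inner y z"
  using l2inner_add_left[OF assms(1) l2_scale[OF assms(2), of "-1"] assms(3)]
    l2inner_scale_left[of "-1" y z] by simp

lemma l2inner_diff_right:
  assumes "x \<in> l2Z" "y \<in> l2Z" "z \<in> l2Z"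
  shows "l2inner z (\<lambda>n. x n - y n) = l2inner z x - l2inner z y"
  using l2inner_diff_left[OF assms] l2inner_cnj
  by (metis complex_cnj_diff)

lemma cmod_l2inner_le:
  assumes "x \<in> l2Z" "y \<in> l2Z"
  shows "cmod (l2inner x y) \<le> l2norm x * l2norm y"
proof -
  have "cmod (l2inner x y) \<le> (\<Sum>\<^sub>\<infinity>n. cmod (x n * cnj (y n)))"
    unfolding l2inner_def using l2_prod_summable(2)[OF assms] by (rule norm_infsum_bound)
  also have "\<dots> \<le> l2norm x * l2norm y"
  proof (rule infsum_le_finite_sums)
    show "(\<lambda>n. cmod (x n * cnj (y n))) summable_on UNIV"
      by (rule l2_prod_summable[OF assms])
    fix F :: "int set"
    assume "finite F"
    have "(\<Sum>n\<in>F. cmod (x n * cnj (y n)))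
        \<le> L2_set (\<lambda>n. cmod (x n)) F * L2_set (\<lambda>n. cmod (y n)) F"
      using L2_set_mult_ineq[of "\<lambda>n. cmod (x n)" "\<lambda>n. cmod (y n)" F] by (simp add: norm_mult)
    also have "\<dots> \<le> l2norm x * l2norm y"
      by (intro mult_mono L2_set_le_l2norm assms) auto
    finally show "(\<Sum>n\<in>F. cmod (x n * cnj (y n))) \<le> l2norm x * l2norm y" .
  qed
  finally show ?thesis .
qed

lemma l2norm_diff_sq:
  assumes "x \<in> l2Z" "y \<in> l2Z"
  shows "(l2norm (\<lambda>n. x n - y n))^2 = (l2norm x)^2 + (l2norm y)^2 - 2 * Re (l2inner x y)"
proof -
  have "complex_of_real ((l2norm (\<lambda>n. x n - y n))^2)
      = l2inner (\<lambda>n. x n - y n) (\<lambda>n. x n - y n)"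
    by (simp only: l2inner_self l2_diff assms)
  also have "\<dots> = l2inner x x - l2inner x y - (l2inner y x - l2inner y y)"
    using assms by (simp add: l2inner_diff_left l2inner_diff_right l2_diff)
  finally have "Re (complex_of_real ((l2norm (\<lambda>n. x n - y n))^2))
      = Re (l2inner x x - l2inner x y - (l2inner y x - l2inner y y))" by simp
  then show ?thesis
    using assms by (simp add: l2inner_self l2inner_cnj[of y x])
qed

lemma l2inner_delta: "l2inner (\<lambda>k. if k = n then 1 else 0) y = cnj (y n)"
proof -
  have "l2inner (\<lambda>k. if k = n then 1 else 0) y = (\<Sum>\<^sub>\<infinity>k\<in>{n}. cnj (y k))"
    unfolding l2inner_def by (rule infsum_cong_neutral) auto
  then show ?thesis by simp
qed

section \<open>Half-line band matrices\<close>

text \<open>Indexing by the offset \<open>d\<close> instead of the column keeps the sum finite for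
  an arbitrary sequence \<open>x\<close>. Columns \<open>i + d \<le> 0\<close> meet only zeros of a
  vector in \<open>l2N\<close>, so on \<open>l2N\<close> this is the compression to the half-line of
  a banded matrix on the whole line.\<close>

definition band_app :: "int \<Rightarrow> (int \<Rightarrow> int \<Rightarrow> complex) \<Rightarrow> (int \<Rightarrow> complex) \<Rightarrow> int \<Rightarrow> complex" where
  "band_app w M x = (\<lambda>i. if 1 \<le> i then \<Sum>d\<in>{-w..w}. M i (i + d) * x (i + d) else 0)"

definition mat_adj :: "(int \<Rightarrow> int \<Rightarrow> complex) \<Rightarrow> int \<Rightarrow> int \<Rightarrow> complex" where
  "mat_adj M = (\<lambda>i j. cnj (M j i))"

definition mat_sub :: "(int \<Rightarrow> int \<Rightarrow> complex) \<Rightarrow> complex \<Rightarrow> int \<Rightarrow> int \<Rightarrow> complex" where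
  "mat_sub M z = (\<lambda>i j. M i j - (if i = j then z else 0))"

definition bounded_by :: "real \<Rightarrow> (int \<Rightarrow> int \<Rightarrow> complex) \<Rightarrow> bool" where
  "bounded_by \<alpha> M \<longleftrightarrow> (\<forall>i j. cmod (M i j) \<le> \<alpha>)"

lemma bounded_by_nonneg: "bounded_by \<alpha> M \<Longrightarrow> 0 \<le> \<alpha>"
  unfolding bounded_by_def using norm_ge_zero order_trans by blast

lemma mat_adj_mat_adj [simp]: "mat_adj (mat_adj M) = M"
  by (simp add: mat_adj_def)

lemma mat_adj_mat_sub: "mat_adj (mat_sub M z) = mat_sub (mat_adj M) (cnj z)"
  by (auto simp: mat_adj_def mat_sub_def fun_eq_iff)

lemma mat_sub_mat_sub: "mat_sub (mat_sub M a) c = mat_sub M (a + c)"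
  by (auto simp: mat_sub_def fun_eq_iff)

lemma bounded_by_mat_adj [simp]: "bounded_by \<alpha> (mat_adj M) \<longleftrightarrow> bounded_by \<alpha> M"
  by (auto simp: bounded_by_def mat_adj_def)

lemma bounded_by_mat_sub: "bounded_by \<alpha> M \<Longrightarrow> bounded_by (\<alpha> + cmod z) (mat_sub M z)"
  unfolding bounded_by_def mat_sub_def
  by (smt (verit, best) norm_triangle_ineq4 norm_zero norm_ge_zero)

lemma band_app_l2:
  assumes "0 \<le> w" "bounded_by \<alpha> M" "x \<in> l2N"
  shows "band_app w M x \<in> l2N" and "l2norm (band_app w M x) \<le> real_of_int (2 * w + 1) * \<alpha> * l2norm x"
proof -
  define f where "f = (\<lambda>d i. if 1 \<le> i then M i (i + d) * x (i + d) else 0)"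
  have le: "cmod (f d i) \<le> \<alpha> * cmod (x (i + d))" for d i
    using assms(2) bounded_by_nonneg[OF assms(2)]
    by (auto simp: f_def norm_mult bounded_by_def intro: mult_right_mono)
  note f = l2_dominated[OF l2N_l2Z[OF assms(3)] bounded_by_nonneg[OF assms(2)] le]
  have eq: "band_app w M x = (\<lambda>i. \<Sum>d\<in>{-w..w}. f d i)"
    by (auto simp: band_app_def f_def)
  have s: "band_app w M x \<in> l2Z \<and> l2norm (band_app w M x) \<le> (\<Sum>d\<in>{-w..w}. l2norm (f d))"
    unfolding eq by (rule l2_sum) (use f in auto)
  then show "band_app w M x \<in> l2N"
    by (auto simp: l2N_def band_app_def)
  have "(\<Sum>d\<in>{-w..w}. l2norm (f d)) \<le> of_nat (card {-w..w}) * (\<alpha> * l2norm x)"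
    by (rule sum_bounded_above) (use f in auto)
  with s assms(1) show "l2norm (band_app w M x) \<le> real_of_int (2 * w + 1) * \<alpha> * l2norm x"
    by (simp add: mult.assoc)
qed

text \<open>\<open>0 \<le> w\<close> puts the main diagonal inside the band, and
  \<open>x \<in> l2N\<close> makes both sides vanish at nonpositive indices, where
  \<open>band_app\<close> is 0 by definition.\<close>

lemma band_app_mat_sub:
  assumes "0 \<le> w" "x \<in> l2N"
  shows "band_app w (mat_sub M z) x = (\<lambda>i. band_app w M x i - z * x i)"
proof
  fix i :: int
  have "(\<Sum>d\<in>{-w..w}. (if d = 0 then z else 0) * x (i + d)) = z * x i"
    using assms(1) by (simp add: if_distrib[of "\<lambda>t. t * _"] sum.delta cong: if_cong)
  then show "band_app w (mat_sub M z) x i = band_app w M x i - z * x i"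
    using l2N_nonpos[OF assms(2), of i]
    by (auto simp: band_app_def mat_sub_def left_diff_distrib sum_subtractf)
qed

lemma band_app_add: "band_app w M (\<lambda>n. x n + y n) = (\<lambda>i. band_app w M x i + band_app w M y i)"
  by (auto simp: band_app_def distrib_left sum.distrib)

lemma band_app_scale: "band_app w M (\<lambda>n. a * x n) = (\<lambda>i. a * band_app w M x i)"
  by (simp add: band_app_def sum_distrib_left mult.left_commute fun_eq_iff)

lemma band_app_diff: "band_app w M (\<lambda>n. x n - y n) = (\<lambda>i. band_app w M x i - band_app w M y i)"
  by (auto simp: band_app_def right_diff_distrib sum_subtractf)

lemma band_app_zero [simp]: "band_app w M (\<lambda>_. 0) = (\<lambda>_. 0)"
  by (auto simp: band_app_def)

lemma infsum_sum_finite: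
  fixes f :: "'a \<Rightarrow> 'b \<Rightarrow> complex"
  assumes "finite D" "\<And>d. d \<in> D \<Longrightarrow> f d summable_on A"
  shows "(\<lambda>i. \<Sum>d\<in>D. f d i) summable_on A \<and> (\<Sum>\<^sub>\<infinity>i\<in>A. \<Sum>d\<in>D. f d i) = (\<Sum>d\<in>D. infsum (f d) A)"
  using assms
  by (induction D rule: finite_induct) (auto simp: infsum_add summable_on_add)

lemma l2inner_band_app:
  assumes "bounded_by \<alpha> M" "x \<in> l2N" "y \<in> l2N"
  shows "l2inner (band_app w M x) y = l2inner x (band_app w (mat_adj M) y)"
proof -
  have *: "(\<lambda>i. N i (i + d) * u (i + d) * cnj (v i)) summable_on UNIV"
    if "bounded_by \<alpha> N" "u \<in> l2N" "v \<in> l2N" for d N u v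
  proof (rule l2_prod_summable(1))
    show "(\<lambda>i. N i (i + d) * u (i + d)) \<in> l2Z"
      by (rule l2_dominated(1)[OF l2N_l2Z[OF that(2)] bounded_by_nonneg[OF that(1)], where d = d])
        (use that(1) in \<open>auto simp: norm_mult bounded_by_def intro: mult_right_mono\<close>)
    show "v \<in> l2Z" by (rule l2N_l2Z[OF that(3)])
  qed
  have exp: "l2inner (band_app w N u) v = (\<Sum>d\<in>{-w..w}. \<Sum>\<^sub>\<infinity>i. N i (i + d) * u (i + d) * cnj (v i))"
    if "bounded_by \<alpha> N" "u \<in> l2N" "v \<in> l2N" for N u v
  proof -
    have "l2inner (band_app w N u) v = (\<Sum>\<^sub>\<infinity>i. \<Sum>d\<in>{-w..w}. N i (i + d) * u (i + d) * cnj (v i))"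
      unfolding l2inner_def
      by (rule infsum_cong) (use l2N_nonpos[OF that(3)] in \<open>auto simp: band_app_def sum_distrib_right\<close>)
    then show ?thesis
      using infsum_sum_finite[of "{-w..w}" "\<lambda>d i. N i (i + d) * u (i + d) * cnj (v i)" UNIV] *[OF that]
      by simp
  qed
  \<comment> \<open>One diagonal at a time: translating the summation index over the integers turns
    the offset \<open>d\<close> of \<open>M\<close> into the offset \<open>-d\<close> of the
    adjoint, and the band \<open>{-w..w}\<close> is symmetric.\<close>
  have flip: "(\<Sum>\<^sub>\<infinity>i. M i (i + d) * x (i + d) * cnj (y i))
      = cnj (\<Sum>\<^sub>\<infinity>i. mat_adj M i (i - d) * y (i - d) * cnj (x i))" for d
  proof -
    have "(\<Sum>\<^sub>\<infinity>i. M i (i + d) * x (i + d) * cnj (y i))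
        = (\<Sum>\<^sub>\<infinity>i. M (i - d) i * x i * cnj (y (i - d)))"
      by (rule infsum_reindex_bij_witness[where i = "\<lambda>i. i - d" and j = "\<lambda>i. i + d"]) auto
    then show ?thesis
      by (simp add: mat_adj_def infsum_cnj[symmetric] mult_ac del: infsum_cnj)
  qed
  have "l2inner (band_app w M x) y
      = cnj (\<Sum>d\<in>{-w..w}. \<Sum>\<^sub>\<infinity>i. mat_adj M i (i - d) * y (i - d) * cnj (x i))"
    using assms by (simp only: exp flip cnj_sum)
  also have "(\<Sum>d\<in>{-w..w}. \<Sum>\<^sub>\<infinity>i. mat_adj M i (i - d) * y (i - d) * cnj (x i))
      = (\<Sum>d\<in>{-w..w}. \<Sum>\<^sub>\<infinity>i. mat_adj M i (i + d) * y (i + d) * cnj (x i))"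
    by (rule sum.reindex_bij_witness[where i = uminus and j = uminus]) auto
  also have "cnj \<dots> = l2inner x (band_app w (mat_adj M) y)"
    using assms by (simp add: exp[symmetric] l2inner_cnj[symmetric])
  finally show ?thesis .
qed

section \<open>Lower bounds and invertibility\<close>

definition lower_bound :: "int \<Rightarrow> (int \<Rightarrow> int \<Rightarrow> complex) \<Rightarrow> real \<Rightarrow> bool" where
  "lower_bound w M c \<longleftrightarrow> (\<forall>x\<in>l2N. c * l2norm x \<le> l2norm (band_app w M x))"

text \<open>Testing the adjoint as well detects a failure of surjectivity: the half-line shift is an
  isometry, so \<open>lower_bound\<close> holds for it with constant 1, but its adjoint kills the
  first unit vector.\<close>

definition lower_modulus :: "int \<Rightarrow> (int \<Rightarrow> int \<Rightarrow> complex) \<Rightarrow> real" where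
  "lower_modulus w M = Sup {c. lower_bound w M c \<and> lower_bound w (mat_adj M) c}"

lemma delta_l2N: "(\<lambda>k::int. if k = 1 then 1 else 0) \<in> l2N"
  and l2norm_delta: "l2norm (\<lambda>k::int. if k = 1 then 1 else 0) = 1"
  by (rule l2N_finite[of "{1}"]; simp) (subst l2norm_finite[of "{1}"]; simp add: L2_set_def)

lemma lower_bound_le:
  assumes "0 \<le> w" "bounded_by \<alpha> M" "lower_bound w M c"
  shows "c \<le> real_of_int (2 * w + 1) * \<alpha>"
  using band_app_l2(2)[OF assms(1,2) delta_l2N] assms(3) delta_l2N
  unfolding lower_bound_def by (fastforce simp: l2norm_delta)

lemma lower_bound_0: "lower_bound w M 0"
  by (simp add: lower_bound_def)

lemma lower_bound_mono: "lower_bound w M c \<Longrightarrow> d \<le> c \<Longrightarrow> lower_bound w M d"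
  unfolding lower_bound_def by (meson l2norm_nonneg mult_right_mono order_trans)

lemma lower_bound_lower_modulus:
  assumes "0 \<le> w" "bounded_by \<alpha> M"
  shows "lower_bound w M (lower_modulus w M)" "lower_bound w (mat_adj M) (lower_modulus w M)"
proof -
  let ?S = "{c. lower_bound w M c \<and> lower_bound w (mat_adj M) c}"
  have ne: "?S \<noteq> {}" using lower_bound_0 by blast
  have *: "lower_modulus w M * l2norm x \<le> l2norm (band_app w N x)" if "x \<in> l2N" "N = M \<or> N = mat_adj M" for x N
  proof (cases "l2norm x = 0")
    case False
    then have pos: "0 < l2norm x" using l2norm_nonneg[of x] by linarith
    have "lower_modulus w M \<le> l2norm (band_app w N x) / l2norm x"
      unfolding lower_modulus_def
      by (rule cSup_least[OF ne]) (use that pos in \<open>auto simp: lower_bound_def pos_le_divide_eq\<close>)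
    then show ?thesis using pos by (simp add: pos_le_divide_eq)
  qed simp
  then show "lower_bound w M (lower_modulus w M)" "lower_bound w (mat_adj M) (lower_modulus w M)"
    unfolding lower_bound_def by auto
qed

lemma le_lower_modulus_iff:
  assumes "0 \<le> w" "bounded_by \<alpha> M"
  shows "c \<le> lower_modulus w M \<longleftrightarrow> lower_bound w M c \<and> lower_bound w (mat_adj M) c"
proof
  assume "c \<le> lower_modulus w M"
  then show "lower_bound w M c \<and> lower_bound w (mat_adj M) c"
    using lower_bound_lower_modulus[OF assms] lower_bound_mono by blast
next
  assume "lower_bound w M c \<and> lower_bound w (mat_adj M) c"
  then show "c \<le> lower_modulus w M"
    unfolding lower_modulus_def
    by (intro cSup_upper) (auto simp: bdd_above_def intro: lower_bound_le[OF assms])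
qed

lemma lower_modulus_nonneg: "0 \<le> w \<Longrightarrow> bounded_by \<alpha> M \<Longrightarrow> 0 \<le> lower_modulus w M"
  by (simp add: le_lower_modulus_iff lower_bound_0)

lemma lower_bound_mat_sub:
  assumes "0 \<le> w" "bounded_by \<alpha> M" "lower_bound w M c"
  shows "lower_bound w (mat_sub M z) (c - cmod z)"
  unfolding lower_bound_def
proof
  fix x assume x: "x \<in> l2N"
  have eq: "band_app w M x = (\<lambda>i. band_app w (mat_sub M z) x i + z * x i)"
    by (simp add: band_app_mat_sub[OF assms(1) x])
  have "c * l2norm x \<le> l2norm (band_app w M x)"
    using assms(3) x by (simp add: lower_bound_def)
  also have "\<dots> \<le> l2norm (band_app w (mat_sub M z) x) + l2norm (\<lambda>i. z * x i)"
    unfolding eq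
    by (rule l2_add; rule l2N_l2Z; intro l2N_scale x band_app_l2(1)[OF assms(1) bounded_by_mat_sub[OF assms(2)]])
  finally show "(c - cmod z) * l2norm x \<le> l2norm (band_app w (mat_sub M z) x)"
    by (simp add: l2norm_scale algebra_simps)
qed

lemma lower_modulus_mat_sub_ge:
  assumes "0 \<le> w" "bounded_by \<alpha> M"
  shows "lower_modulus w M - cmod z \<le> lower_modulus w (mat_sub M z)"
  unfolding le_lower_modulus_iff[OF assms(1) bounded_by_mat_sub[OF assms(2)]] mat_adj_mat_sub
  using lower_bound_mat_sub[OF assms lower_bound_lower_modulus(1)[OF assms], of z]
    lower_bound_mat_sub[OF assms(1) _ lower_bound_lower_modulus(2)[OF assms], of \<alpha> "cnj z"] assms(2)
  by simp

lemma lower_modulus_lipschitz: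
  assumes "0 \<le> w" "bounded_by \<alpha> M"
  shows "\<bar>lower_modulus w (mat_sub M a) - lower_modulus w (mat_sub M c)\<bar> \<le> cmod (a - c)"
proof -
  have "lower_modulus w (mat_sub M a) - cmod (c - a) \<le> lower_modulus w (mat_sub M c)" for a c
    using lower_modulus_mat_sub_ge[OF assms(1) bounded_by_mat_sub[OF assms(2)], of a "c - a"]
    by (simp add: mat_sub_mat_sub)
  from this[of a c] this[of c a] show ?thesis
    by (simp add: norm_minus_commute abs_le_iff)
qed

text \<open>Confines the points of small lower modulus to a disc whose radius depends only on
  \<open>w\<close>, \<open>\<alpha>\<close> and the level, so that later constants can be chosen
  uniformly in \<open>M\<close> and \<open>z\<close>.\<close>

lemma lower_modulus_ge_norm:
  assumes "0 \<le> w" "bounded_by \<alpha> M"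
  shows "cmod z - real_of_int (2 * w + 1) * \<alpha> \<le> lower_modulus w (mat_sub M z)"
proof -
  have *: "lower_bound w (mat_sub N z) (cmod z - real_of_int (2 * w + 1) * \<alpha>)" if N: "bounded_by \<alpha> N" for N z
    unfolding lower_bound_def
  proof
    fix x assume x: "x \<in> l2N"
    note A = band_app_l2[OF assms(1) N x] band_app_l2(1)[OF assms(1) bounded_by_mat_sub[OF N] x, of z]
    have "cmod z * l2norm x = l2norm (\<lambda>i. z * x i)"
      by (simp add: l2norm_scale)
    also have "(\<lambda>i. z * x i) = (\<lambda>i. band_app w N x i - band_app w (mat_sub N z) x i)"
      by (simp add: band_app_mat_sub[OF assms(1) x])
    also have "l2norm \<dots> \<le> l2norm (band_app w N x) + l2norm (band_app w (mat_sub N z) x)"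
      by (rule l2_diff; rule l2N_l2Z; rule A)
    finally show "(cmod z - real_of_int (2 * w + 1) * \<alpha>) * l2norm x \<le> l2norm (band_app w (mat_sub N z) x)"
      using A(2) by (simp add: left_diff_distrib)
  qed
  show ?thesis
    unfolding le_lower_modulus_iff[OF assms(1) bounded_by_mat_sub[OF assms(2)]] mat_adj_mat_sub
    using *[of M z] *[of "mat_adj M" "cnj z"] assms(2) by simp
qed

section \<open>Pointwise limits and surjectivity\<close>

lemma band_app_tendsto:
  assumes "\<And>i. (\<lambda>n. X n i) \<longlonglongrightarrow> x i"
  shows "(\<lambda>n. band_app w M (X n) i) \<longlonglongrightarrow> band_app w M x i"
  unfolding band_app_def by (auto intro!: tendsto_intros assms)

lemma l2_pointwise_limit:
  assumes "\<And>i. (\<lambda>n. X n i) \<longlonglongrightarrow> x i" "\<And>n. X n \<in> l2N" "\<And>n. l2norm (X n) \<le> C"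
  shows "x \<in> l2N"
proof -
  have C: "0 \<le> C" using assms(3)[of 0] l2norm_nonneg order_trans by blast
  have "L2_set (\<lambda>i. cmod (x i)) F \<le> C" for F
  proof (rule LIMSEQ_le_const2)
    show "(\<lambda>n. L2_set (\<lambda>i. cmod (X n i)) F) \<longlonglongrightarrow> L2_set (\<lambda>i. cmod (x i)) F"
      unfolding L2_set_def by (intro tendsto_intros assms)
    show "\<exists>N. \<forall>n\<ge>N. L2_set (\<lambda>i. cmod (X n i)) F \<le> C"
      using assms L2_set_le_l2norm l2N_l2Z by (meson order_trans)
  qed
  then have "x \<in> l2Z" by (rule l2_boundedI(1)[OF C])
  moreover have "x i = 0" if "i \<le> 0" for i
    using assms(1)[of i] l2N_nonpos[OF assms(2) that] by (simp add: LIMSEQ_const_iff)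
  ultimately show ?thesis by (simp add: l2N_def)
qed

text \<open>Surjectivity needs no completeness: the Neumann series for \<open>B B\<^sup>*\<close> converges pointwise, and
  band matrices are continuous for pointwise convergence.\<close>

lemma band_app_surj:
  assumes w: "0 \<le> w" and M: "bounded_by \<alpha> M" and c: "0 < c"
    and lb: "lower_bound w (mat_adj M) c" and z: "z \<in> l2N"
  shows "\<exists>x\<in>l2N. band_app w M x = z"
proof -
  define K where "K = real_of_int (2 * w + 1) * \<alpha>"
  \<comment> \<open>\<open>T\<close> is \<open>B B^*\<close> for the operator \<open>B\<close> of
    \<open>M\<close>, and the solution comes from the Neumann series of \<open>G = I - t T\<close>.
    With \<open>t = 1 / K^2\<close> one has \<open>\<parallel>t T y\<parallel>^2 \<le> t
    \<parallel>B^* y\<parallel>^2\<close>, which absorbs half of the cross term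
    \<open>2 t \<parallel>B^* y\<parallel>^2\<close>; the other half gives the contraction factor
    \<open>q\<close>.\<close>
  define t where "t = 1 / K^2"
  define q where "q = sqrt (1 - t * c^2)"
  define T where "T = (\<lambda>y. band_app w M (band_app w (mat_adj M) y))"
  define G where "G = (\<lambda>y i. y i - of_real t * T y i)"
  define Y where "Y = (\<lambda>k. (G ^^ k) (\<lambda>i. of_real t * z i))"
  define S where "S = (\<lambda>n i. \<Sum>k<n. Y k i)"
  have M': "bounded_by \<alpha> (mat_adj M)" using M by simp
  have cK: "c \<le> K" using lower_bound_le[OF w M' lb] by (simp add: K_def)
  with c have K: "0 < K" by simp
  then have t: "0 < t" by (simp add: t_def)
  have tc: "0 < t * c^2" using t c by simp
  have "t * c^2 \<le> t * K^2" using cK c t by (simp add: power_mono)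
  also have "t * K^2 = 1" using K by (simp add: t_def)
  finally have tc1: "t * c^2 \<le> 1" .
  have q: "0 \<le> q" "q < 1" and q2: "q^2 = 1 - t * c^2" using tc tc1 by (auto simp: q_def)
  have T: "T y \<in> l2N" if "y \<in> l2N" for y
    unfolding T_def by (intro band_app_l2(1)[OF w M] band_app_l2(1)[OF w M'] that)
  have G: "G y \<in> l2N" if "y \<in> l2N" for y
    unfolding G_def by (intro l2N_diff l2N_scale T that)
  have Gle: "l2norm (G y) \<le> q * l2norm y" if y: "y \<in> l2N" for y
  proof -
    define v where "v = band_app w (mat_adj M) y"
    have v: "v \<in> l2N" unfolding v_def by (rule band_app_l2(1)[OF w M' y])
    have Tv: "T y = band_app w M v" by (simp add: T_def v_def)
    have "l2inner y (T y) = l2inner v v"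
      using l2inner_band_app[OF M' y v, of w] by (simp add: Tv v_def)
    then have ip: "l2inner y (\<lambda>i. of_real t * T y i) = of_real (t * (l2norm v)^2)"
      using l2inner_cnj[of y "\<lambda>i. of_real t * T y i"] l2inner_cnj[of y "T y"]
      by (simp add: l2inner_scale_left l2inner_self l2N_l2Z v)
    have "(l2norm (G y))^2
        = (l2norm y)^2 + (l2norm (\<lambda>i. of_real t * T y i))^2 - 2 * (t * (l2norm v)^2)"
      unfolding G_def
      using l2norm_diff_sq[OF l2N_l2Z[OF y] l2N_l2Z[OF l2N_scale[OF T[OF y]]], of "of_real t"]
      by (simp add: ip)
    moreover have "(l2norm (\<lambda>i. of_real t * T y i))^2 \<le> t * (l2norm v)^2"
    proof -
      have "(l2norm (\<lambda>i. of_real t * T y i))^2 = (t * l2norm (T y))^2"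
        using t by (simp add: l2norm_scale)
      also have "\<dots> \<le> (t * (K * l2norm v))^2"
        using band_app_l2(2)[OF w M v] t unfolding Tv K_def
        by (intro power_mono mult_left_mono) auto
      also have "\<dots> = t * (l2norm v)^2"
        using K by (simp add: t_def power2_eq_square)
      finally show ?thesis .
    qed
    moreover have "t * (c * l2norm y)^2 \<le> t * (l2norm v)^2"
      using lb y c t unfolding lower_bound_def v_def
      by (intro mult_left_mono power_mono) auto
    moreover have "(q * l2norm y)^2 = (l2norm y)^2 - t * (c * l2norm y)^2"
      by (simp add: power_mult_distrib q2 algebra_simps)
    ultimately have "(l2norm (G y))^2 \<le> (q * l2norm y)^2" by linarith
    then show ?thesis
      by (rule power2_le_imp_le) (intro mult_nonneg_nonneg q l2norm_nonneg)
  qed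
  define C where "C = l2norm (\<lambda>i. of_real t * z i)"
  have Y: "Y k \<in> l2N \<and> l2norm (Y k) \<le> q ^ k * C" for k
  proof (induction k)
    case 0
    then show ?case using z by (simp add: Y_def C_def l2N_scale)
  next
    case (Suc k)
    have "l2norm (G (Y k)) \<le> q * l2norm (Y k)" using Gle Suc by blast
    also have "\<dots> \<le> q * (q ^ k * C)" using Suc q by (intro mult_left_mono) auto
    finally show ?case using Suc G by (simp add: Y_def mult.assoc)
  qed
  have Ypt: "norm (Y k i) \<le> q ^ k * C" for k i
    using Y[of k] cmod_le_l2norm[of "Y k" i] l2N_l2Z by fastforce
  have geo: "summable (\<lambda>k. q ^ k * C)"
    using q by (intro summable_mult2 summable_geometric) auto
  define s where "s = (\<lambda>i. \<Sum>k. Y k i)"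
  have lim: "(\<lambda>n. S n i) \<longlonglongrightarrow> s i" for i
    unfolding S_def s_def
    by (rule summable_LIMSEQ, rule summable_comparison_test'[OF geo, of 0]) (use Ypt in auto)
  have SN: "S n \<in> l2N" for n
    by (induction n) (use Y l2N_finite[of "{}"] l2N_add in \<open>auto simp: S_def\<close>)
  have s: "s \<in> l2N"
  proof (rule l2_pointwise_limit[OF lim SN])
    fix n
    have "l2norm (S n) \<le> (\<Sum>k<n. l2norm (Y k))"
      unfolding S_def using l2_sum[of "{..<n}" Y] Y l2N_l2Z by blast
    also have "\<dots> \<le> (\<Sum>k<n. q ^ k * C)" using Y by (intro sum_mono) auto
    also have "\<dots> \<le> (\<Sum>k. q ^ k * C)"
      using q by (intro sum_le_suminf[OF geo]) (auto simp: C_def)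
    finally show "l2norm (S n) \<le> (\<Sum>k. q ^ k * C)" .
  qed
  \<comment> \<open>Telescoping: since \<open>t T = I - G\<close>, applying it to the
    \<open>n\<close>-th partial sum leaves the first term minus the \<open>n\<close>-th one.\<close>
  have TS: "of_real t * T (S n) i = of_real t * z i - Y n i" for n i
  proof (induction n)
    case 0
    have "S 0 = (\<lambda>_. 0)" by (simp add: S_def)
    then show ?case by (simp add: T_def Y_def)
  next
    case (Suc n)
    have "S (Suc n) = (\<lambda>i. S n i + Y n i)" by (simp add: S_def)
    then have "T (S (Suc n)) i = T (S n) i + T (Y n) i" by (simp add: T_def band_app_add)
    moreover have "Y (Suc n) i = Y n i - of_real t * T (Y n) i" by (simp add: Y_def G_def)
    ultimately show ?case using Suc by (simp add: distrib_left)
  qed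
  have "T s i = z i" for i
  proof -
    have "(\<lambda>n. T (S n) i) \<longlonglongrightarrow> T s i"
      unfolding T_def by (intro band_app_tendsto lim)
    then have "(\<lambda>n. of_real t * T (S n) i) \<longlonglongrightarrow> of_real t * T s i"
      by (intro tendsto_intros)
    then have 1: "(\<lambda>n. of_real t * z i - Y n i) \<longlonglongrightarrow> of_real t * T s i" by (simp only: TS)
    have "(\<lambda>n. Y n i) \<longlonglongrightarrow> 0"
      by (rule Lim_null_comparison[OF _ summable_LIMSEQ_zero[OF geo]]) (use Ypt in auto)
    then have "(\<lambda>n. of_real t * z i - Y n i) \<longlonglongrightarrow> of_real t * z i - 0" by (intro tendsto_intros)
    with 1 have "of_real t * T s i = of_real t * z i - 0" by (rule LIMSEQ_unique)
    then show ?thesis using t by simp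
  qed
  then have "band_app w M (band_app w (mat_adj M) s) = z" by (auto simp: T_def)
  then show ?thesis using band_app_l2(1)[OF w M' s] by blast
qed

text \<open>Operators and matrices are compared on \<open>l2N\<close> only. Since
  \<open>inv_into l2N\<close> looks at no value outside \<open>l2N\<close>, invertibility and the
  norm of the inverse do not see the rest.\<close>

lemma
  assumes "\<And>x. x \<in> l2N \<Longrightarrow> A x = B x"
  shows invertibleN_cong: "invertibleN A \<longleftrightarrow> invertibleN B"
    and inv_norm_cong: "inv_norm A = inv_norm B"
proof -
  have "inv_into l2N A = inv_into l2N B"
    unfolding inv_into_def using assms by (intro ext arg_cong[where f = Eps]) auto
  moreover have "bij_betw A l2N l2N \<longleftrightarrow> bij_betw B l2N l2N"
    by (rule bij_betw_cong) (rule assms)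
  ultimately show "invertibleN A \<longleftrightarrow> invertibleN B" "inv_norm A = inv_norm B"
    unfolding invertibleN_def inv_norm_def by (simp_all only:)
qed

text \<open>For \<open>y = M x\<close>, Cauchy-Schwarz gives \<open>\<parallel>y\<parallel>^2 = <x,
  M^* y> \<le> \<parallel>x\<parallel> \<parallel>M^* y\<parallel>\<close>, and
  \<open>c \<parallel>x\<parallel> \<le> \<parallel>y\<parallel>\<close>. So for a surjective matrix
  positive lower bounds have to be checked on one side only.\<close>

lemma lower_bound_mat_adj:
  assumes M: "bounded_by \<alpha> M" "0 \<le> w" and c: "0 < c" and lb: "lower_bound w M c"
    and surj: "\<And>z. z \<in> l2N \<Longrightarrow> \<exists>x\<in>l2N. band_app w M x = z"
  shows "lower_bound w (mat_adj M) c"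
  unfolding lower_bound_def
proof
  fix y assume y: "y \<in> l2N"
  obtain x where x: "x \<in> l2N" "band_app w M x = y" using surj[OF y] by blast
  have My: "band_app w (mat_adj M) y \<in> l2N" using band_app_l2(1)[OF M(2) _ y, of \<alpha>] M by simp
  have cx: "c * l2norm x \<le> l2norm y" using lb x unfolding lower_bound_def by blast
  have "complex_of_real ((l2norm y)^2) = l2inner x (band_app w (mat_adj M) y)"
    using l2inner_band_app[OF M(1) x(1) y, of w] by (simp add: x(2) l2inner_self[OF l2N_l2Z[OF y]])
  then have "cmod (complex_of_real ((l2norm y)^2)) \<le> l2norm x * l2norm (band_app w (mat_adj M) y)"
    using cmod_l2inner_le[OF l2N_l2Z[OF x(1)] l2N_l2Z[OF My]] by simp
  then have "(l2norm y)^2 \<le> l2norm x * l2norm (band_app w (mat_adj M) y)"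
    by (simp add: norm_power)
  then have "c * (l2norm y)^2 \<le> c * l2norm x * l2norm (band_app w (mat_adj M) y)"
    using c by (simp add: mult.assoc)
  also have "\<dots> \<le> l2norm y * l2norm (band_app w (mat_adj M) y)"
    by (rule mult_right_mono[OF cx]) simp
  finally have "l2norm y * (c * l2norm y) \<le> l2norm y * l2norm (band_app w (mat_adj M) y)"
    by (simp add: power2_eq_square algebra_simps)
  then show "c * l2norm y \<le> l2norm (band_app w (mat_adj M) y)"
    using l2norm_nonneg[of y] l2norm_nonneg[of "band_app w (mat_adj M) y"] by (cases "l2norm y = 0") auto
qed

lemma band_app_bij:
  assumes "0 \<le> w" "bounded_by \<alpha> M" "0 < lower_modulus w M"
  shows "bij_betw (band_app w M) l2N l2N"
proof -
  have lb: "lower_bound w M (lower_modulus w M)" "lower_bound w (mat_adj M) (lower_modulus w M)"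
    using lower_bound_lower_modulus[OF assms(1,2)] by auto
  have "x = y" if xy: "x \<in> l2N" "y \<in> l2N" "band_app w M x = band_app w M y" for x y
  proof -
    have "band_app w M (\<lambda>i. x i - y i) = (\<lambda>_. 0)" by (simp add: band_app_diff xy)
    then have "lower_modulus w M * l2norm (\<lambda>i. x i - y i) \<le> 0"
      using lb(1) l2N_diff[OF xy(1,2)] l2norm_finite[of "{}" "\<lambda>_. 0"]
      by (fastforce simp: lower_bound_def)
    then have "l2norm (\<lambda>i. x i - y i) = 0"
      using assms(3) l2norm_nonneg[of "\<lambda>i. x i - y i"] by (simp add: mult_le_0_iff)
    then have "(\<lambda>i. x i - y i) = (\<lambda>_. 0)"
      by (rule l2norm_eq_0[OF l2N_l2Z[OF l2N_diff[OF xy(1,2)]]])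
    then show ?thesis by (auto simp: fun_eq_iff)
  qed
  moreover have "band_app w M ` l2N = l2N"
    using band_app_surj[OF assms(1,2,3) lb(2)] band_app_l2(1)[OF assms(1,2)] by fastforce
  ultimately show ?thesis by (auto simp: bij_betw_def inj_on_def)
qed

lemma band_app_inverse:
  assumes "bij_betw (band_app w M) l2N l2N" "y \<in> l2N"
  shows "inv_into l2N (band_app w M) y \<in> l2N" "band_app w M (inv_into l2N (band_app w M) y) = y"
  using assms by (metis bij_betw_imp_surj_on inv_into_into, metis bij_betw_inv_into_right)

lemma lower_modulus_pos_iff_invertible:
  assumes "0 \<le> w" "bounded_by \<alpha> M"
  shows "invertibleN (band_app w M) \<longleftrightarrow> 0 < lower_modulus w M"
proof
  assume inv: "invertibleN (band_app w M)"
  then obtain C where C: "\<forall>y\<in>l2N. l2norm (inv_into l2N (band_app w M) y) \<le> C * l2norm y"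
    and bij: "bij_betw (band_app w M) l2N l2N" unfolding invertibleN_def by blast
  define D where "D = max C 1"
  have D: "l2norm (inv_into l2N (band_app w M) y) \<le> D * l2norm y" if "y \<in> l2N" for y
    using C that unfolding D_def by (meson l2norm_nonneg max.cobounded1 mult_right_mono order_trans)
  have D0: "0 < D" by (simp add: D_def)
  have "lower_bound w M (1 / D)"
    unfolding lower_bound_def
  proof
    fix x assume x: "x \<in> l2N"
    have "l2norm x \<le> D * l2norm (band_app w M x)"
      using D[OF band_app_l2(1)[OF assms x]] bij_betw_inv_into_left[OF bij x] by simp
    then show "1 / D * l2norm x \<le> l2norm (band_app w M x)"
      using D0 by (simp add: field_simps)
  qed
  moreover from this have "lower_bound w (mat_adj M) (1 / D)"
    using band_app_inverse[OF bij] D0 by (intro lower_bound_mat_adj[OF assms(2,1)]) auto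
  ultimately have "1 / D \<le> lower_modulus w M" by (simp add: le_lower_modulus_iff[OF assms])
  then show "0 < lower_modulus w M" using D0 by (meson divide_pos_pos less_le_trans zero_less_one)
next
  assume pos: "0 < lower_modulus w M"
  note bij = band_app_bij[OF assms pos]
  have "l2norm (inv_into l2N (band_app w M) y) \<le> 1 / lower_modulus w M * l2norm y" if "y \<in> l2N" for y
  proof -
    have "lower_modulus w M * l2norm (inv_into l2N (band_app w M) y) \<le> l2norm y"
      using lower_bound_lower_modulus(1)[OF assms] band_app_inverse[OF bij that]
      unfolding lower_bound_def by metis
    then show ?thesis using pos by (simp add: field_simps)
  qed
  then show "invertibleN (band_app w M)"
    unfolding invertibleN_def using bij by blast
qed

text \<open>If the matrix is not invertible, both sides are infinite, since
  \<open>inverse 0 = \<infinity>\<close> in the extended reals. Otherwise a bound \<open>s\<close>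
  for the inverse on the unit ball gives, by scaling, the lower bound \<open>1 / s\<close> for
  \<open>M\<close> and then for its adjoint.\<close>

lemma inv_norm_band_app:
  assumes "0 \<le> w" "bounded_by \<alpha> M"
  shows "inv_norm (band_app w M) = inverse (ereal (lower_modulus w M))"
proof (cases "0 < lower_modulus w M")
  case False
  then have "lower_modulus w M = 0" using lower_modulus_nonneg[OF assms] by simp
  then show ?thesis
    using lower_modulus_pos_iff_invertible[OF assms] by (simp add: inv_norm_def)
next
  case pos: True
  note bij = band_app_bij[OF assms pos]
  let ?A = "{ereal (l2norm (inv_into l2N (band_app w M) y)) | y. y \<in> l2N \<and> l2norm y \<le> 1}"
  have "Sup ?A = ereal (1 / lower_modulus w M)"
  proof (rule Sup_eqI)
    fix e assume "e \<in> ?A"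
    then obtain y where y: "y \<in> l2N" "l2norm y \<le> 1"
      and e: "e = ereal (l2norm (inv_into l2N (band_app w M) y))" by blast
    have "lower_modulus w M * l2norm (inv_into l2N (band_app w M) y) \<le> l2norm y"
      using lower_bound_lower_modulus(1)[OF assms] band_app_inverse[OF bij y(1)]
      unfolding lower_bound_def by metis
    with y(2) have "lower_modulus w M * l2norm (inv_into l2N (band_app w M) y) \<le> 1" by linarith
    then show "e \<le> ereal (1 / lower_modulus w M)"
      using pos by (simp add: e field_simps)
  next
    fix e assume ub: "\<And>a. a \<in> ?A \<Longrightarrow> a \<le> e"
    have inv: "ereal (l2norm (inv_into l2N (band_app w M) y)) \<le> e" if "y \<in> l2N" "l2norm y \<le> 1" for y
      using ub that by blast
    show "ereal (1 / lower_modulus w M) \<le> e"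
    proof (cases e)
      case (real s)
      have le: "l2norm x \<le> s * l2norm (band_app w M x)" if x: "x \<in> l2N" for x
      proof (cases "l2norm (band_app w M x) = 0")
        case True
        then have "l2norm x = 0"
          using lower_bound_lower_modulus(1)[OF assms] x pos l2norm_nonneg[of x]
          unfolding lower_bound_def by (metis less_eq_real_def mult_le_cancel_left_pos mult_zero_right order_antisym)
        then show ?thesis using True by simp
      next
        case False
        define a where "a = 1 / l2norm (band_app w M x)"
        have a: "0 < a" using False l2norm_nonneg[of "band_app w M x"] by (simp add: a_def less_le)
        have ax: "(\<lambda>n. of_real a * x n) \<in> l2N" by (rule l2N_scale[OF x])
        have "l2norm (band_app w M (\<lambda>n. of_real a * x n)) = a * l2norm (band_app w M x)"
          using a by (simp add: band_app_scale l2norm_scale)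
        also have "\<dots> = 1" using False by (simp add: a_def)
        finally have "l2norm (band_app w M (\<lambda>n. of_real a * x n)) \<le> 1" by simp
        from inv[OF band_app_l2(1)[OF assms ax] this]
        have "l2norm (\<lambda>n. of_real a * x n) \<le> s"
          by (simp add: real bij_betw_inv_into_left[OF bij ax])
        then have "a * l2norm x \<le> s" using a by (simp add: l2norm_scale)
        then show ?thesis
          using False a by (simp add: a_def field_simps split: if_splits)
      qed
      have s: "0 < s"
        using le[OF delta_l2N] l2norm_nonneg[of "band_app w M (\<lambda>k. if k = 1 then 1 else 0)"]
        unfolding l2norm_delta by (metis less_le_trans mult_le_0_iff not_less zero_less_one)
      then have "lower_bound w M (1 / s)"
        unfolding lower_bound_def using le by (simp add: field_simps)
      moreover from this have "lower_bound w (mat_adj M) (1 / s)"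
        using band_app_inverse[OF bij] s by (intro lower_bound_mat_adj[OF assms(2,1)]) auto
      ultimately have "1 / s \<le> lower_modulus w M" by (simp add: le_lower_modulus_iff[OF assms])
      then show ?thesis using s pos by (simp add: real field_simps)
    next
      case MInf
      then show ?thesis using inv[OF l2N_scale[OF delta_l2N, of 0]] by (simp add: l2norm_scale)
    qed simp
  qed
  then show ?thesis
    using lower_modulus_pos_iff_invertible[OF assms] pos
    by (simp add: inv_norm_def inverse_eq_divide)
qed

section \<open>Decrease of the lower modulus under a small change of the spectral parameter\<close>

lemma cmod_sq_sum_fourth_roots:
  "(cmod (a + b + c))^2 + (cmod (a + \<i> * b - c))^2 + (cmod (a - b + c))^2 + (cmod (a - \<i> * b - c))^2
    = 4 * ((cmod a)^2 + (cmod b)^2 + (cmod c)^2)"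
  unfolding cmod_power2 by (simp add: power2_eq_square algebra_simps)

text \<open>Parseval on the four points \<open>\<omega> = \<rho> \<i>^k\<close>: the cross terms
  between the powers 1, \<open>\<omega>\<close>, \<open>\<omega>^2\<close> cancel in the sum, and
  one of the four values is at least their mean. The nonnegative contribution of \<open>z\<close> to
  the mean is dropped.\<close>

lemma exists_fourth_root_l2norm_ge:
  assumes "x \<in> l2Z" "y \<in> l2Z" "z \<in> l2Z" "0 \<le> \<rho>"
  shows "\<exists>\<omega>. cmod \<omega> = \<rho> \<and>
    (l2norm x)^2 + \<rho>^2 * (l2norm y)^2 \<le> (l2norm (\<lambda>n. x n + \<omega> * y n + \<omega>^2 * z n))^2"
proof (rule ccontr)
  let ?v = "\<lambda>\<omega> n. x n + \<omega> * y n + \<omega>^2 * z n"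
  let ?r = "complex_of_real \<rho>"
  let ?b = "(l2norm x)^2 + \<rho>^2 * (l2norm y)^2"
  assume "\<not> ?thesis"
  then have lt: "(l2norm (?v \<omega>))^2 < ?b" if "cmod \<omega> = \<rho>" for \<omega>
    using that by (auto simp: not_le)
  have S: "(\<lambda>n. (cmod (?v \<omega> n))^2) summable_on UNIV" for \<omega>
    using l2_add(1)[OF l2_add(1)[OF assms(1) l2_scale[OF assms(2)]] l2_scale[OF assms(3)]]
    by (simp add: l2Z_def)
  have X: "(\<lambda>n. (cmod (x n))^2) summable_on UNIV" "(\<lambda>n. (cmod (y n))^2) summable_on UNIV"
    "(\<lambda>n. (cmod (z n))^2) summable_on UNIV" using assms by (auto simp: l2Z_def)
  have "(l2norm (?v ?r))^2 + (l2norm (?v (\<i> * ?r)))^2 + (l2norm (?v (- ?r)))^2 + (l2norm (?v (- \<i> * ?r)))^2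
     = (\<Sum>\<^sub>\<infinity>n. (cmod (?v ?r n))^2 + (cmod (?v (\<i> * ?r) n))^2 + (cmod (?v (- ?r) n))^2 + (cmod (?v (- \<i> * ?r) n))^2)"
    unfolding l2norm_sq by (simp only: infsum_add summable_on_add S)
  also have "\<dots> = (\<Sum>\<^sub>\<infinity>n. 4 * ((cmod (x n))^2 + \<rho>^2 * (cmod (y n))^2 + \<rho>^4 * (cmod (z n))^2))"
  proof (rule infsum_cong)
    fix n
    show "(cmod (?v ?r n))^2 + (cmod (?v (\<i> * ?r) n))^2 + (cmod (?v (- ?r) n))^2 + (cmod (?v (- \<i> * ?r) n))^2
      = 4 * ((cmod (x n))^2 + \<rho>^2 * (cmod (y n))^2 + \<rho>^4 * (cmod (z n))^2)"
      using cmod_sq_sum_fourth_roots[of "x n" "?r * y n" "?r^2 * z n"]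
      by (simp add: power_mult_distrib norm_mult norm_power mult.assoc flip: power_mult)
  qed
  also have "\<dots> = 4 * ((l2norm x)^2 + \<rho>^2 * (l2norm y)^2 + \<rho>^4 * (l2norm z)^2)"
    unfolding l2norm_sq
    by (simp add: infsum_cmult_right' infsum_add summable_on_add summable_on_cmult_right X)
  finally have "4 * ?b \<le> (l2norm (?v ?r))^2 + (l2norm (?v (\<i> * ?r)))^2
      + (l2norm (?v (- ?r)))^2 + (l2norm (?v (- \<i> * ?r)))^2"
    using assms(4) by (simp add: distrib_left)
  with lt[of ?r] lt[of "\<i> * ?r"] lt[of "- ?r"] lt[of "- \<i> * ?r"] assms(4)
  show False by (simp add: norm_mult)
qed

text \<open>For the operator \<open>B\<close> of \<open>M\<close>, \<open>r = B^{-1} z\<close> and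
  \<open>s = B^{-2} z\<close>. The smaller the bound \<open>\<kappa>\<close> on
  \<open>\<parallel>z\<parallel> / \<parallel>r\<parallel>\<close>, the larger the gain
  \<open>\<rho>^2 / \<kappa>^2\<close>, which has to beat the error \<open>\<rho>^3 / c^2\<close>.
  In general \<open>\<kappa>\<close> is a bound on the operator norm; for normal matrices it can be
  taken close to the lower modulus.\<close>

lemma lower_bound_descent:
  assumes w: "0 \<le> w" and M: "bounded_by \<alpha> M" and c: "0 < c" "lower_bound w M c"
    and z: "z \<in> l2N" "z \<noteq> (\<lambda>_. 0)" "l2norm (band_app w M z) \<le> a * l2norm z"
    and r: "r \<in> l2N" "band_app w M r = z" and s: "s \<in> l2N" "band_app w M s = r"
    and \<kappa>: "0 < \<kappa>" "l2norm z \<le> \<kappa> * l2norm r" and \<rho>: "0 \<le> \<rho>"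
  shows "\<exists>\<omega>. cmod \<omega> = \<rho> \<and> lower_modulus w (mat_sub M \<omega>) * sqrt (1 + \<rho>^2 / \<kappa>^2) \<le> a + \<rho>^3 / c^2"
proof -
  obtain \<omega> where \<omega>: "cmod \<omega> = \<rho>"
    and ge: "(l2norm z)^2 + \<rho>^2 * (l2norm r)^2 \<le> (l2norm (\<lambda>n. z n + \<omega> * r n + \<omega>^2 * s n))^2"
    using exists_fourth_root_l2norm_ge[OF z(1)[THEN l2N_l2Z] r(1)[THEN l2N_l2Z] s(1)[THEN l2N_l2Z] \<rho>]
    by blast
  define v where "v = (\<lambda>n. z n + \<omega> * r n + \<omega>^2 * s n)"
  have v: "v \<in> l2N" unfolding v_def by (intro l2N_add l2N_scale z r s)
  have nz: "0 < l2norm z" by (rule l2norm_pos[OF l2N_l2Z[OF z(1)] z(2)])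
  have "(l2norm z)^2 * (1 + \<rho>^2 / \<kappa>^2) \<le> (l2norm z)^2 + \<rho>^2 * (l2norm r)^2"
  proof -
    have "(l2norm z)^2 \<le> (\<kappa> * l2norm r)^2" by (intro power_mono \<kappa>) simp
    then have "\<rho>^2 / \<kappa>^2 * (l2norm z)^2 \<le> \<rho>^2 / \<kappa>^2 * (\<kappa>^2 * (l2norm r)^2)"
      by (intro mult_left_mono) (auto simp: power_mult_distrib)
    also have "\<dots> = \<rho>^2 * (l2norm r)^2" using \<kappa>(1) by simp
    finally show ?thesis by (simp add: algebra_simps)
  qed
  with ge have "(l2norm z)^2 * (1 + \<rho>^2 / \<kappa>^2) \<le> (l2norm v)^2" by (simp add: v_def)
  then have "sqrt ((l2norm z)^2 * (1 + \<rho>^2 / \<kappa>^2)) \<le> sqrt ((l2norm v)^2)"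
    by (rule real_sqrt_le_mono)
  then have vge: "l2norm z * sqrt (1 + \<rho>^2 / \<kappa>^2) \<le> l2norm v"
    by (simp add: real_sqrt_mult)
  have cs: "c * l2norm s \<le> l2norm r" "c * l2norm r \<le> l2norm z"
    using c(2) r s unfolding lower_bound_def by metis+
  have "c^2 * l2norm s = c * (c * l2norm s)" by (simp add: power2_eq_square)
  also have "\<dots> \<le> c * l2norm r" using cs(1) c by (intro mult_left_mono) auto
  finally have s_le: "c^2 * l2norm s \<le> l2norm z" using cs(2) by simp
  have Mv: "band_app w M v = (\<lambda>i. band_app w M z i + \<omega> * z i + \<omega>^2 * r i)"
    unfolding v_def by (simp only: band_app_add band_app_scale r s)
  \<comment> \<open>The terms \<open>\<omega> z\<close> and \<open>\<omega>^2 r\<close> produced by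
    \<open>M\<close> cancel against those of \<open>\<omega> v\<close>.\<close>
  have eq: "band_app w (mat_sub M \<omega>) v = (\<lambda>i. band_app w M z i - \<omega>^3 * s i)"
    unfolding band_app_mat_sub[OF w v] Mv
    by (simp add: v_def algebra_simps power2_eq_square power3_eq_cube)
  have "lower_modulus w (mat_sub M \<omega>) * l2norm v \<le> l2norm (band_app w (mat_sub M \<omega>) v)"
    using lower_bound_lower_modulus(1)[OF w bounded_by_mat_sub[OF M], of \<omega>] v by (simp add: lower_bound_def)
  also have "\<dots> \<le> l2norm (band_app w M z) + l2norm (\<lambda>i. \<omega>^3 * s i)"
    unfolding eq by (rule l2_diff; rule l2N_l2Z; intro l2N_scale band_app_l2(1)[OF w M] z s)
  also have "l2norm (\<lambda>i. \<omega>^3 * s i) = \<rho>^3 * l2norm s"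
    by (simp add: l2norm_scale norm_power \<omega>)
  also have "\<rho>^3 * l2norm s \<le> \<rho>^3 / c^2 * l2norm z"
  proof -
    have "l2norm s \<le> l2norm z / c^2" using s_le c(1) by (simp add: field_simps)
    then have "\<rho>^3 * l2norm s \<le> \<rho>^3 * (l2norm z / c^2)" using \<rho> by (intro mult_left_mono) auto
    then show ?thesis by simp
  qed
  finally have le: "lower_modulus w (mat_sub M \<omega>) * l2norm v \<le> (a + \<rho>^3 / c^2) * l2norm z"
    using z(3) by (simp add: distrib_right)
  have "lower_modulus w (mat_sub M \<omega>) * (l2norm z * sqrt (1 + \<rho>^2 / \<kappa>^2)) \<le> lower_modulus w (mat_sub M \<omega>) * l2norm v"
    by (rule mult_left_mono[OF vge lower_modulus_nonneg[OF w bounded_by_mat_sub[OF M]]])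
  also note le
  finally have "lower_modulus w (mat_sub M \<omega>) * sqrt (1 + \<rho>^2 / \<kappa>^2) * l2norm z \<le> (a + \<rho>^3 / c^2) * l2norm z"
    by (simp add: mult_ac)
  then show ?thesis using nz \<omega> by auto
qed

section \<open>Localization to finite windows\<close>

definition window_bound :: "int \<Rightarrow> (int \<Rightarrow> int \<Rightarrow> complex) \<Rightarrow> int \<Rightarrow> real \<Rightarrow> bool" where
  "window_bound w M D c \<longleftrightarrow>
    (\<forall>p\<ge>1. \<forall>x. (\<forall>i. i \<notin> {p..<p + D} \<longrightarrow> x i = 0) \<longrightarrow> c * l2norm x \<le> l2norm (band_app w M x))"

lemma window_boundI:
  assumes "lower_bound w M c"
  shows "window_bound w M D c"
  unfolding window_bound_def
proof (intro allI impI)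
  fix p :: int and x :: "int \<Rightarrow> complex"
  assume "1 \<le> p" "\<forall>i. i \<notin> {p..<p + D} \<longrightarrow> x i = 0"
  then have "x \<in> l2N" by (intro l2N_finite[of "{p..<p + D}"]) auto
  then show "c * l2norm x \<le> l2norm (band_app w M x)" using assms by (simp add: lower_bound_def)
qed

text \<open>The test vector is translated from position \<open>p\<close> to position
  \<open>q\<close>. Its image occupies rows from \<open>p - w\<close> on, so the cut at row 1 is not
  felt when both positions exceed \<open>w\<close>; otherwise the window stays in place.\<close>

lemma window_bound_transfer:
  assumes wb: "window_bound w M' D c"
    and loc: "\<And>p. 1 \<le> p \<Longrightarrow> \<exists>q. (q = p \<or> w < p \<and> w < q) \<and>
      (\<forall>i j. 1 \<le> i \<longrightarrow> p \<le> j \<longrightarrow> j < p + D \<longrightarrow> \<bar>i - j\<bar> \<le> w \<longrightarrow> M' (i + (q - p)) (j + (q - p)) = M i j)"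
    and w: "0 \<le> w"
  shows "window_bound w M D c"
  unfolding window_bound_def
proof (intro allI impI)
  fix p :: int and x :: "int \<Rightarrow> complex"
  assume p: "1 \<le> p" and supp: "\<forall>i. i \<notin> {p..<p + D} \<longrightarrow> x i = 0"
  from loc[OF p] obtain q where q: "q = p \<or> w < p \<and> w < q"
    and eq: "\<And>i j. 1 \<le> i \<Longrightarrow> p \<le> j \<Longrightarrow> j < p + D \<Longrightarrow> \<bar>i - j\<bar> \<le> w
      \<Longrightarrow> M' (i + (q - p)) (j + (q - p)) = M i j" by blast
  define t where "t = q - p"
  define x' where "x' = (\<lambda>i. x (i - t))"
  have shift: "l2norm (\<lambda>i. y (i - t)) = l2norm y" for y
    unfolding l2norm_def
    by (rule arg_cong[where f = sqrt], rule infsum_reindex_bij_witness[where i = "\<lambda>i. i + t" and j = "\<lambda>i. i - t"]) auto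
  have "band_app w M' x' i = band_app w M x (i - t)" for i
  proof -
    have summand: "(if 1 \<le> i then M' i (i + d) * x' (i + d) else 0)
        = (if 1 \<le> i - t then M (i - t) (i - t + d) * x (i - t + d) else 0)" if d: "d \<in> {-w..w}" for d
    proof (cases "x (i - t + d) = 0")
      case True
      then show ?thesis by (simp add: x'_def algebra_simps)
    next
      case False
      then have r: "p \<le> i - t + d" "i - t + d < p + D" using supp by force+
      then have "1 \<le> i \<longleftrightarrow> 1 \<le> i - t" using q d by (auto simp: t_def)
      moreover have "M' i (i + d) = M (i - t) (i - t + d)" if "1 \<le> i - t"
        using eq[of "i - t" "i - t + d"] r that d unfolding t_def by (auto simp: algebra_simps)
      ultimately show ?thesis by (simp add: x'_def algebra_simps)
    qed
    have "band_app w M' x' i = (\<Sum>d\<in>{-w..w}. if 1 \<le> i then M' i (i + d) * x' (i + d) else 0)"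
      by (simp add: band_app_def)
    also have "\<dots> = (\<Sum>d\<in>{-w..w}. if 1 \<le> i - t then M (i - t) (i - t + d) * x (i - t + d) else 0)"
      by (rule sum.cong[OF refl summand])
    also have "\<dots> = band_app w M x (i - t)" by (simp add: band_app_def)
    finally show ?thesis .
  qed
  then have "band_app w M' x' = (\<lambda>i. band_app w M x (i - t))" by blast
  then have n: "l2norm (band_app w M' x') = l2norm (band_app w M x)" "l2norm x' = l2norm x"
    by (simp_all only: shift x'_def)
  have "1 \<le> q" using q p w by auto
  moreover have "\<forall>i. i \<notin> {q..<q + D} \<longrightarrow> x' i = 0"
    using supp by (auto simp: x'_def t_def)
  ultimately show "c * l2norm x \<le> l2norm (band_app w M x)"
    using wb unfolding window_bound_def n[symmetric] by blast
qed

section \<open>Overlapping windows and the commutator estimate\<close>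

lemma L2_set_sum_le:
  "finite D \<Longrightarrow> L2_set (\<lambda>i. \<Sum>d\<in>D. f d i) A \<le> (\<Sum>d\<in>D. L2_set (f d) A)"
proof (induction D rule: finite_induct)
  case empty
  then show ?case by (simp add: L2_set_def)
next
  case (insert d D)
  then show ?case
    using L2_set_triangle_ineq[of "f d" "\<lambda>i. \<Sum>d\<in>D. f d i" A] by simp
qed

text \<open>Exchanging the sums leaves, at each \<open>i\<close>, only the total squared weight over
  \<open>j\<close>. This is applied with \<open>c = D\<close> to the cut-offs themselves and with
  \<open>c = 2 * w\<close> to their differences.\<close>

lemma L2_set_weighted_product:
  fixes f :: "'a \<Rightarrow> 'b \<Rightarrow> real"
  assumes "finite I" "finite J" "\<And>i. i \<in> I \<Longrightarrow> (\<Sum>j\<in>J. (f j i)^2) \<le> c" "0 \<le> c"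
  shows "L2_set (\<lambda>(j, i). f j i * g i) (J \<times> I) \<le> sqrt c * L2_set g I"
proof -
  have "(\<Sum>(j, i)\<in>J \<times> I. (f j i * g i)^2) = (\<Sum>j\<in>J. \<Sum>i\<in>I. (f j i)^2 * (g i)^2)"
    by (simp add: sum.cartesian_product power_mult_distrib)
  also have "\<dots> = (\<Sum>i\<in>I. (\<Sum>j\<in>J. (f j i)^2) * (g i)^2)"
    by (subst sum.swap) (simp add: sum_distrib_right)
  also have "\<dots> \<le> (\<Sum>i\<in>I. c * (g i)^2)"
    by (intro sum_mono mult_right_mono assms) auto
  finally have "sqrt (\<Sum>(j, i)\<in>J \<times> I. (f j i * g i)^2) \<le> sqrt (c * (\<Sum>i\<in>I. (g i)^2))"
    by (intro real_sqrt_le_mono) (simp add: sum_distrib_left)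
  then show ?thesis
    by (simp add: L2_set_def real_sqrt_mult split_def)
qed

text \<open>The left ends \<open>j\<close> start at \<open>1 - D\<close>, so that points near 1 also
  lie in exactly \<open>D\<close> windows, some of which reach past the boundary.\<close>

lemma card_window:
  fixes D :: int
  assumes "0 \<le> D" "i \<in> {1..N}"
  shows "(\<Sum>j\<in>{1 - D..N}. (of_bool (j \<le> i \<and> i < j + D) :: real)) = D"
proof -
  have "{1 - D..N} \<inter> {j. j \<le> i \<and> i < j + D} = {i - D + 1..i}" using assms by auto
  then show ?thesis using assms by (simp add: sum.If_cases of_bool_def)
qed

text \<open>The two indicators differ only if an end of the window separates \<open>i\<close> from
  \<open>i + d\<close>. Each of the two ends allows at most \<open>\<bar>d\<bar>\<close> positions
  \<open>j\<close>, whatever \<open>D\<close> is.\<close>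

lemma card_window_boundary:
  fixes D :: int
  assumes "finite J"
  shows "(\<Sum>j\<in>J. (of_bool (j \<le> i + d \<and> i + d < j + D) - of_bool (j \<le> i \<and> i < j + D) :: real)^2)
    \<le> 2 * \<bar>d\<bar>"
proof -
  let ?B = "{j. (j \<le> i + d \<and> i + d < j + D) \<noteq> (j \<le> i \<and> i < j + D)}"
  let ?C = "if 0 \<le> d then {i - D + 1..i - D + d} \<union> {i + 1..i + d}
    else {i + d - D + 1..i - D} \<union> {i + d + 1..i}"
  have "(\<Sum>j\<in>J. (of_bool (j \<le> i + d \<and> i + d < j + D) - of_bool (j \<le> i \<and> i < j + D) :: real)^2)
      = (\<Sum>j\<in>J. if j \<in> ?B then 1 else 0)"
    by (rule sum.cong) auto
  also have "\<dots> = card (J \<inter> ?B)"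
    using assms by (simp add: sum.If_cases)
  also have "J \<inter> ?B \<subseteq> ?C" by auto
  then have "card (J \<inter> ?B) \<le> card ?C" by (intro card_mono) auto
  also have "card ?C \<le> 2 * nat \<bar>d\<bar>"
    using card_Un_le[of "{i - D + 1..i - D + d}" "{i + 1..i + d}"]
      card_Un_le[of "{i + d - D + 1..i - D}" "{i + d + 1..i}"] by simp
  finally show ?thesis by simp
qed

text \<open>Sharp cut-offs to the windows \<open>{j..<j + D}\<close> commute with a band matrix up to the window
  boundaries. Summed over all \<open>j\<close>, every point lies in \<open>D\<close> windows but only near boundedly many
  boundaries; the diagonal drops out of the commutator, so the error does not depend on it.\<close>

lemma window_bound_finite_support:
  assumes w: "0 \<le> w" and D: "1 \<le> D" and c: "0 \<le> c" and \<alpha>: "0 \<le> \<alpha>"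
    and off: "\<And>i j. i \<noteq> j \<Longrightarrow> cmod (M i j) \<le> \<alpha>"
    and wb: "window_bound w M D c"
    and supp: "\<And>i. i \<notin> {1..n} \<Longrightarrow> x i = 0"
  shows "sqrt D * (c * l2norm x)
    \<le> sqrt D * l2norm (band_app w M x) + real_of_int (2 * w + 1) * (\<alpha> * sqrt (2 * w)) * l2norm x"
proof -
  \<comment> \<open>\<open>I\<close> contains the supports of \<open>x\<close> and of its image, and
    \<open>J\<close> the left ends of all windows that meet \<open>I\<close>. The weight
    \<open>h d\<close> is what remains on the \<open>d\<close>-th diagonal of the commutator; it
    vanishes for \<open>d = 0\<close>.\<close>
  define I where "I = {1..n + w}"
  define J where "J = {1 - D..n + w}"
  define \<phi> where "\<phi> = (\<lambda>j i :: int. of_bool (j \<le> i \<and> i < j + D) :: real)"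
  define \<psi> where "\<psi> = (\<lambda>j i. complex_of_real (\<phi> j i) * x i)"
  define h where "h = (\<lambda>d (j, i). \<phi> j (i + d) - \<phi> j i :: real)"
  have IJ: "finite I" "finite J" by (auto simp: I_def J_def)
  have \<phi>2: "(\<phi> j i)^2 = \<phi> j i" for j i by (simp add: \<phi>_def)
  have card: "(\<Sum>j\<in>J. (\<phi> j i)^2) = D" if "i \<in> I" for i
    unfolding \<phi>2 unfolding \<phi>_def J_def by (rule card_window) (use D that in \<open>auto simp: I_def\<close>)
  have app_supp: "band_app w M y i = 0" if "i \<notin> I" "\<And>k. k \<notin> {1..n} \<Longrightarrow> y k = 0" for y i
    using that w by (auto simp: band_app_def I_def intro!: sum.neutral)
  have x_norm: "l2norm x = L2_set (\<lambda>i. cmod (x i)) I"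
    by (rule l2norm_finite) (use supp w in \<open>auto simp: I_def\<close>)
  have Mx_norm: "l2norm (band_app w M x) = L2_set (\<lambda>i. cmod (band_app w M x i)) I"
    by (rule l2norm_finite) (use app_supp supp IJ in auto)
  have \<psi>_supp: "\<psi> j k = 0" if "k \<notin> {1..n}" for j k using supp[OF that] by (simp add: \<psi>_def)
  have \<psi>_bound: "c^2 * (\<Sum>i\<in>I. (\<phi> j i * cmod (x i))^2) \<le> (\<Sum>i\<in>I. (cmod (band_app w M (\<psi> j) i))^2)" for j
  proof -
    \<comment> \<open>\<open>window_bound\<close> admits only positive starting points, so a window
      with \<open>j \<le> 0\<close> is replaced by the one starting at 1; as \<open>x\<close>
      vanishes left of 1, the latter still contains the support.\<close>
    have "\<psi> j i = 0" if "i \<notin> {max 1 j..<max 1 j + D}" for i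
      using that D supp[of i] by (auto simp: \<psi>_def \<phi>_def)
    then have "c * l2norm (\<psi> j) \<le> l2norm (band_app w M (\<psi> j))"
      using wb unfolding window_bound_def by (metis max.cobounded1)
    then have "(c * l2norm (\<psi> j))^2 \<le> (l2norm (band_app w M (\<psi> j)))^2"
      using c by (intro power_mono) auto
    moreover have "l2norm (\<psi> j) = L2_set (\<lambda>i. cmod (\<psi> j i)) I"
      by (rule l2norm_finite) (use \<psi>_supp w in \<open>auto simp: I_def\<close>)
    moreover have "l2norm (band_app w M (\<psi> j)) = L2_set (\<lambda>i. cmod (band_app w M (\<psi> j) i)) I"
      by (rule l2norm_finite) (use app_supp \<psi>_supp IJ in auto)
    moreover have "cmod (\<psi> j i) = \<phi> j i * cmod (x i)" for i
      by (simp add: \<psi>_def norm_mult \<phi>_def)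
    ultimately show ?thesis
      by (simp add: L2_set_def sum_nonneg power_mult_distrib)
  qed
  have lhs: "sqrt D * (c * l2norm x) \<le> L2_set (\<lambda>(j, i). cmod (band_app w M (\<psi> j) i)) (J \<times> I)"
  proof -
    have "real_of_int D * (c * l2norm x)^2 = c^2 * (\<Sum>i\<in>I. (\<Sum>j\<in>J. (\<phi> j i)^2) * (cmod (x i))^2)"
      by (simp add: x_norm L2_set_def sum_nonneg power_mult_distrib card sum_distrib_left[symmetric])
    also have "\<dots> = (\<Sum>j\<in>J. c^2 * (\<Sum>i\<in>I. (\<phi> j i * cmod (x i))^2))"
      unfolding sum_distrib_right sum_distrib_left[symmetric]
      by (subst sum.swap) (simp add: power_mult_distrib)
    also have "\<dots> \<le> (\<Sum>j\<in>J. \<Sum>i\<in>I. (cmod (band_app w M (\<psi> j) i))^2)"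
      by (rule sum_mono) (rule \<psi>_bound)
    finally have "sqrt (real_of_int D * (c * l2norm x)^2) \<le> sqrt (\<Sum>(j, i)\<in>J \<times> I. (cmod (band_app w M (\<psi> j) i))^2)"
      by (intro real_sqrt_le_mono) (simp add: sum.cartesian_product)
    then show ?thesis
      using c by (simp add: real_sqrt_mult L2_set_def split_def)
  qed
  \<comment> \<open>Writing \<open>\<phi> j (i + d) = \<phi> j i + h d (j, i)\<close> splits the
    image of the cut-off vector into the cut-off of the image and the commutator.\<close>
  have pt: "cmod (band_app w M (\<psi> j) i) \<le> \<phi> j i * cmod (band_app w M x i)
      + (\<Sum>d\<in>{-w..w}. \<alpha> * (\<bar>h d (j, i)\<bar> * cmod (x (i + d))))" if "i \<in> I" for j i
  proof -
    have i: "1 \<le> i" using that by (simp add: I_def)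
    have "band_app w M (\<psi> j) i = \<phi> j i * band_app w M x i
        + (\<Sum>d\<in>{-w..w}. M i (i + d) * (complex_of_real (h d (j, i)) * x (i + d)))"
      using i by (simp add: band_app_def \<psi>_def h_def sum_distrib_left sum.distrib[symmetric] algebra_simps)
    then have "cmod (band_app w M (\<psi> j) i) \<le> cmod (\<phi> j i * band_app w M x i)
        + (\<Sum>d\<in>{-w..w}. cmod (M i (i + d) * (complex_of_real (h d (j, i)) * x (i + d))))"
      by (simp only: order_trans[OF norm_triangle_ineq add_left_mono[OF norm_sum]])
    also have "\<dots> \<le> \<phi> j i * cmod (band_app w M x i)
      + (\<Sum>d\<in>{-w..w}. \<alpha> * (\<bar>h d (j, i)\<bar> * cmod (x (i + d))))"
    proof (intro add_mono sum_mono)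
      fix d
      show "cmod (M i (i + d) * (complex_of_real (h d (j, i)) * x (i + d)))
          \<le> \<alpha> * (\<bar>h d (j, i)\<bar> * cmod (x (i + d)))"
      proof (cases "d = 0")
        case False
        then have "cmod (M i (i + d)) \<le> \<alpha>" by (intro off) simp
        then show ?thesis
          unfolding norm_mult norm_of_real by (rule mult_right_mono) simp
      qed (simp add: h_def)
    qed (simp add: norm_mult \<phi>_def)
    finally show ?thesis .
  qed
  let ?g = "\<lambda>(j, i). \<phi> j i * cmod (band_app w M x i)"
  let ?h = "\<lambda>d p. \<alpha> * (\<bar>h d p\<bar> * cmod (x (snd p + d)))"
  have "L2_set (\<lambda>(j, i). cmod (band_app w M (\<psi> j) i)) (J \<times> I)
      \<le> L2_set (\<lambda>p. ?g p + (\<Sum>d\<in>{-w..w}. ?h d p)) (J \<times> I)"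
    using pt by (intro L2_set_mono) auto
  also have "\<dots> \<le> L2_set ?g (J \<times> I) + L2_set (\<lambda>p. \<Sum>d\<in>{-w..w}. ?h d p) (J \<times> I)"
    by (rule L2_set_triangle_ineq)
  also have "L2_set ?g (J \<times> I) \<le> sqrt D * l2norm (band_app w M x)"
    unfolding Mx_norm by (rule L2_set_weighted_product[OF IJ]) (use card D in auto)
  also have "L2_set (\<lambda>p. \<Sum>d\<in>{-w..w}. ?h d p) (J \<times> I) \<le> (\<Sum>d\<in>{-w..w}. L2_set (?h d) (J \<times> I))"
    by (rule L2_set_sum_le) simp
  also have "\<dots> \<le> of_nat (card {-w..w}) * (\<alpha> * sqrt (2 * w) * l2norm x)"
  proof (rule sum_bounded_above)
    fix d assume d: "d \<in> {-w..w}"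
    have "L2_set (\<lambda>(j, i). \<bar>h d (j, i)\<bar> * cmod (x (i + d))) (J \<times> I)
        \<le> sqrt (2 * w) * L2_set (\<lambda>i. cmod (x (i + d))) I"
    proof (rule L2_set_weighted_product[OF IJ])
      fix i
      have "(\<Sum>j\<in>J. \<bar>h d (j, i)\<bar>^2) \<le> 2 * \<bar>d\<bar>"
        using card_window_boundary[OF IJ(2), of i d D] by (simp add: h_def \<phi>_def)
      also have "\<dots> \<le> 2 * w" using d by auto
      finally show "(\<Sum>j\<in>J. \<bar>h d (j, i)\<bar>^2) \<le> real_of_int (2 * w)" by simp
    qed (use w in auto)
    also have "L2_set (\<lambda>i. cmod (x (i + d))) I = L2_set (\<lambda>i. cmod (x i)) ((\<lambda>i. i + d) ` I)"
      by (simp add: L2_set_def sum.reindex)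
    also have "\<dots> \<le> l2norm x"
      by (rule L2_set_le_l2norm, rule l2Z_finite[of "{1..n}"]) (use supp in auto)
    finally have "L2_set (\<lambda>(j, i). \<bar>h d (j, i)\<bar> * cmod (x (i + d))) (J \<times> I) \<le> sqrt (2 * w) * l2norm x"
      using w by (simp add: mult_left_mono)
    then have "\<alpha> * L2_set (\<lambda>(j, i). \<bar>h d (j, i)\<bar> * cmod (x (i + d))) (J \<times> I) \<le> \<alpha> * (sqrt (2 * w) * l2norm x)"
      using \<alpha> by (rule mult_left_mono)
    then show "L2_set (?h d) (J \<times> I) \<le> \<alpha> * sqrt (2 * w) * l2norm x"
      using \<alpha> by (simp add: L2_set_right_distrib split_def mult.assoc)
  qed
  finally show ?thesis
    using lhs w by (simp add: mult.assoc)
qed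

lemma l2N_truncate:
  assumes "x \<in> l2N" "0 < e"
  shows "\<exists>n. l2norm (\<lambda>i. x i - (if i \<le> n then x i else 0)) \<le> e"
proof -
  let ?f = "\<lambda>i. (cmod (x i))^2"
  have S: "?f summable_on UNIV" using l2N_l2Z[OF assms(1)] by (simp add: l2Z_def)
  have "\<exists>F. finite F \<and> infsum ?f UNIV - e^2 < sum ?f F"
  proof (rule ccontr)
    assume "\<not> ?thesis"
    then have "infsum ?f UNIV \<le> infsum ?f UNIV - e^2"
      by (intro infsum_le_finite_sums[OF S]) (auto simp: not_less)
    then show False using assms(2) by simp
  qed
  then obtain F where F: "finite F" "infsum ?f UNIV - e^2 < sum ?f F" by blast
  define n where "n = Max (insert 0 F)"
  have "L2_set (\<lambda>i. cmod (x i - (if i \<le> n then x i else 0))) G \<le> e" if G: "finite G" for G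
  proof -
    have "(\<Sum>i\<in>G. (cmod (x i - (if i \<le> n then x i else 0)))^2) = (\<Sum>i\<in>G \<inter> {n<..}. ?f i)"
      using G by (intro sum.mono_neutral_cong_right) auto
    moreover have "F \<inter> (G \<inter> {n<..}) = {}"
      using F(1) Max_ge[of "insert 0 F"] by (fastforce simp: n_def)
    then have "sum ?f F + sum ?f (G \<inter> {n<..}) = sum ?f (F \<union> (G \<inter> {n<..}))"
      using F G by (simp add: sum.union_disjoint)
    moreover have "\<dots> \<le> infsum ?f UNIV"
      using F G by (intro finite_sum_le_infsum[OF S]) auto
    ultimately have "(\<Sum>i\<in>G. (cmod (x i - (if i \<le> n then x i else 0)))^2) \<le> e^2"
      using F(2) by linarith
    then show ?thesis unfolding L2_set_def using assms(2) by (simp add: real_le_lsqrt)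
  qed
  then show ?thesis using l2_boundedI(2)[of e] assms(2) by (meson less_imp_le)
qed

text \<open>Truncation extends the estimate from finite supports to \<open>l2N\<close>. The bound
  \<open>\<beta>\<close> on all entries enters only the truncation error, which can be made
  arbitrarily small; the loss involves only the off-diagonal bound \<open>\<alpha>\<close>, so
  subtracting a scalar from the matrix does not change it.\<close>

lemma lower_bound_of_window:
  assumes w: "0 \<le> w" and D: "1 \<le> D" and M: "bounded_by \<beta> M"
    and off: "\<And>i j. i \<noteq> j \<Longrightarrow> cmod (M i j) \<le> \<alpha>"
    and wb: "window_bound w M D c"
  shows "lower_bound w M (c - real_of_int (2 * w + 1) * (\<alpha> * sqrt (2 * w)) / sqrt D)"
proof -
  define E where "E = real_of_int (2 * w + 1) * (\<alpha> * sqrt (2 * w)) / sqrt D"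
  define K where "K = real_of_int (2 * w + 1) * \<beta>"
  have \<alpha>: "0 \<le> \<alpha>" using off[of 0 1] norm_ge_zero order_trans by (metis zero_neq_one)
  have K: "0 \<le> K" using w bounded_by_nonneg[OF M] by (simp add: K_def)
  have E: "0 \<le> E" using \<alpha> w D by (simp add: E_def)
  show ?thesis
  proof (cases "c - E \<le> 0")
    case True
    then show ?thesis using lower_bound_mono[OF lower_bound_0] by (simp add: E_def)
  next
    case False
    then have c: "0 \<le> c" using E by simp
    show ?thesis
      unfolding lower_bound_def E_def[symmetric]
    proof
      fix x assume x: "x \<in> l2N"
      show "(c - E) * l2norm x \<le> l2norm (band_app w M x)"
      proof (rule field_le_epsilon)
        fix e :: real assume e: "0 < e"
        \<comment> \<open>The discarded tail costs \<open>(c - E) * \<delta>\<close> on the left and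
          \<open>K * \<delta>\<close> on the right, together \<open>e\<close>.\<close>
        define \<delta> where "\<delta> = e / (K + (c - E))"
        have KE: "0 < K + (c - E)" using K False by simp
        have \<delta>: "0 < \<delta>" using e KE by (simp add: \<delta>_def)
        obtain n where n: "l2norm (\<lambda>i. x i - (if i \<le> n then x i else 0)) \<le> \<delta>"
          using l2N_truncate[OF x \<delta>] by blast
        define y where "y = (\<lambda>i. if i \<le> n then x i else 0)"
        define r where "r = (\<lambda>i. x i - y i)"
        have supp: "y i = 0" if "i \<notin> {1..n}" for i
          using that l2N_nonpos[OF x, of i] by (auto simp: y_def)
        have y: "y \<in> l2N" by (rule l2N_finite[of "{1..n}"]) (use supp in auto)
        have r: "r \<in> l2N" unfolding r_def by (rule l2N_diff[OF x y])
        have rn: "l2norm r \<le> \<delta>" using n by (simp add: r_def y_def)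
        have "sqrt D * (c * l2norm y)
            \<le> sqrt D * l2norm (band_app w M y) + real_of_int (2 * w + 1) * (\<alpha> * sqrt (2 * w)) * l2norm y"
          by (rule window_bound_finite_support[OF w D c \<alpha> off wb supp])
        also have "real_of_int (2 * w + 1) * (\<alpha> * sqrt (2 * w)) = sqrt D * E"
          using D by (simp add: E_def)
        finally have "sqrt D * (c * l2norm y) \<le> sqrt D * (l2norm (band_app w M y) + E * l2norm y)"
          by (simp add: algebra_simps)
        then have "c * l2norm y \<le> l2norm (band_app w M y) + E * l2norm y"
          by (rule mult_left_le_imp_le) (use D in simp)
        then have 1: "(c - E) * l2norm y \<le> l2norm (band_app w M y)"
          by (simp add: algebra_simps)
        have "l2norm x = l2norm (\<lambda>i. y i + r i)" by (simp add: r_def)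
        also have "\<dots> \<le> l2norm y + l2norm r" by (rule l2_add(2)) (use y r l2N_l2Z in auto)
        finally have 2: "l2norm x \<le> l2norm y + \<delta>" using rn by simp
        have "l2norm (band_app w M y) = l2norm (band_app w M (\<lambda>i. x i - r i))" by (simp add: r_def)
        also have "\<dots> \<le> l2norm (band_app w M x) + l2norm (band_app w M r)"
          unfolding band_app_diff by (rule l2_diff(2); rule l2N_l2Z; rule band_app_l2(1)[OF w M]; rule x r)
        also have "l2norm (band_app w M r) \<le> K * \<delta>"
          using band_app_l2(2)[OF w M r] rn K unfolding K_def
          by (meson mult_left_mono order_trans)
        finally have 3: "l2norm (band_app w M y) \<le> l2norm (band_app w M x) + K * \<delta>" by simp
        have "(c - E) * l2norm x \<le> (c - E) * (l2norm y + \<delta>)"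
          using 2 False by (intro mult_left_mono) auto
        also have "\<dots> \<le> l2norm (band_app w M x) + (K + (c - E)) * \<delta>"
          using 1 3 by (simp add: algebra_simps)
        also have "(K + (c - E)) * \<delta> = e" using KE by (simp add: \<delta>_def)
        finally show "(c - E) * l2norm x \<le> l2norm (band_app w M x) + e" .
      qed
    qed
  qed
qed

section \<open>Pseudospectra and spectra near approximate eigenvalues\<close>

text \<open>\<open>lower_modulus\<close> also involves the adjoint, yet once \<open>M\<close> is
  invertible a constant above it must already fail for \<open>M\<close> itself, as it would
  otherwise pass to the adjoint. So approximate minimizers exist on the side of
  \<open>M\<close>.\<close>

lemma near_minimizer:
  assumes w: "0 \<le> w" and M: "bounded_by \<alpha> M" and pos: "0 < lower_modulus w M" and a: "lower_modulus w M < a"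
  obtains z r s where "z \<in> l2N" "z \<noteq> (\<lambda>_. 0)" "l2norm (band_app w M z) \<le> a * l2norm z"
    "r \<in> l2N" "band_app w M r = z" "s \<in> l2N" "band_app w M s = r"
proof -
  note bij = band_app_bij[OF w M pos]
  have "\<not> lower_bound w M a"
  proof
    assume lb: "lower_bound w M a"
    have "lower_bound w (mat_adj M) a"
      by (rule lower_bound_mat_adj[OF M w _ lb]) (use pos a band_app_inverse[OF bij] in auto)
    with lb have "a \<le> lower_modulus w M" by (simp add: le_lower_modulus_iff[OF w M])
    with a show False by simp
  qed
  then obtain z where z: "z \<in> l2N" "l2norm (band_app w M z) < a * l2norm z"
    unfolding lower_bound_def by (auto simp: not_le)
  moreover from z have "z \<noteq> (\<lambda>_. 0)" by auto
  ultimately show ?thesis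
    using that band_app_inverse[OF bij] by (meson less_imp_le)
qed

text \<open>Excludes plateaus of the lower modulus at the level \<open>\<epsilon>\<close>, across
  which a pseudospectrum could jump under a small perturbation. Since \<open>\<delta>\<close>
  depends on \<open>M\<close> only through \<open>\<alpha>\<close>, one choice serves the limit
  operator and its approximants alike.\<close>

lemma lower_bound_pseudospectrum:
  assumes w: "0 \<le> w" and \<alpha>: "0 \<le> \<alpha>" and \<epsilon>: "0 < \<epsilon>" and \<eta>: "0 < \<eta>"
  shows "\<exists>\<delta>>0. \<forall>M z. bounded_by \<alpha> M \<longrightarrow> lower_modulus w (mat_sub M z) < \<epsilon> + \<delta>
    \<longrightarrow> (\<exists>z'. dist z' z \<le> \<eta> \<and> lower_modulus w (mat_sub M z') < \<epsilon>)"
proof -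
  define K where "K = real_of_int (2 * w + 1) * \<alpha>"
  \<comment> \<open>A lower modulus below \<open>\<epsilon> + 1\<close> forces
    \<open>cmod z \<le> K + \<epsilon> + 1\<close>, so \<open>\<kappa>\<close> bounds the norm of
    \<open>M - z\<close>. Then \<open>\<rho>\<close> is small enough for the relative cubic error
    \<open>u\<close> to satisfy \<open>3 * u < \<rho>^2 / \<kappa>^2\<close>, whence
    \<open>1 + u < S\<close>; a third of the resulting margin, capped at 1, is
    \<open>\<delta>\<close>.\<close>
  define \<kappa> where "\<kappa> = real_of_int (2 * w + 1) * (\<alpha> + (K + \<epsilon> + 1))"
  define \<rho> where "\<rho> = min \<eta> (min \<epsilon> (\<epsilon>^3 / (6 * \<kappa>^2)))"
  define u where "u = \<rho>^3 / \<epsilon>^3"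
  define S where "S = sqrt (1 + \<rho>^2 / \<kappa>^2)"
  define \<delta> where "\<delta> = min 1 ((\<epsilon> * S - \<epsilon> * (1 + u)) / 3)"
  have K: "0 \<le> K" using w \<alpha> by (simp add: K_def)
  have \<kappa>: "0 < \<kappa>" unfolding \<kappa>_def using w \<alpha> K \<epsilon> by (intro mult_pos_pos) auto
  have \<rho>: "0 < \<rho>" "\<rho> \<le> \<eta>" "\<rho> \<le> \<epsilon>" "\<rho> \<le> \<epsilon>^3 / (6 * \<kappa>^2)"
    using \<eta> \<epsilon> \<kappa> by (auto simp: \<rho>_def)
  have u0: "0 \<le> u" using \<rho> \<epsilon> by (simp add: u_def)
  have u1: "u \<le> 1" using power_mono[OF \<rho>(3), of 3] \<rho>(1) \<epsilon> by (simp add: u_def)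
  have "3 * u < \<rho>^2 / \<kappa>^2"
  proof -
    have "6 * \<kappa>^2 * \<rho> \<le> \<epsilon>^3" using \<rho>(4) \<kappa> by (simp add: field_simps)
    then have "6 * \<kappa>^2 * \<rho> * \<rho>^2 \<le> \<epsilon>^3 * \<rho>^2" by (rule mult_right_mono) simp
    then have "6 * (\<kappa>^2 * \<rho>^3) \<le> \<epsilon>^3 * \<rho>^2" by (simp add: power2_eq_square power3_eq_cube mult_ac)
    moreover have "0 < \<kappa>^2 * \<rho>^3" using \<kappa> \<rho> by simp
    ultimately have "3 * (\<kappa>^2 * \<rho>^3) < \<epsilon>^3 * \<rho>^2" by linarith
    then show ?thesis using \<kappa> \<epsilon> by (simp add: u_def field_simps)
  qed
  moreover have "u^2 \<le> u" using u0 u1 by (simp add: power2_eq_square mult_left_le)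
  ultimately have "(1 + u)^2 < 1 + \<rho>^2 / \<kappa>^2" by (simp add: power2_sum)
  then have uS: "1 + u < S" unfolding S_def by (rule real_less_rsqrt)
  then have "0 < \<epsilon> * S - \<epsilon> * (1 + u)" using \<epsilon> by simp
  then have \<delta>: "0 < \<delta>" "\<delta> \<le> 1" by (simp_all add: \<delta>_def)
  have "\<delta> \<le> (\<epsilon> * S - \<epsilon> * (1 + u)) / 3" unfolding \<delta>_def by (rule min.cobounded2)
  then have \<delta>3: "3 * \<delta> \<le> \<epsilon> * S - \<epsilon> * (1 + u)"
    by (simp add: pos_le_divide_eq mult.commute)
  have S: "0 < S" using uS u0 by simp
  show ?thesis
  proof (intro exI[of _ \<delta>] conjI allI impI \<delta>(1))
    fix M z
    assume M: "bounded_by \<alpha> M" and lt: "lower_modulus w (mat_sub M z) < \<epsilon> + \<delta>"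
    show "\<exists>z'. dist z' z \<le> \<eta> \<and> lower_modulus w (mat_sub M z') < \<epsilon>"
    proof (cases "lower_modulus w (mat_sub M z) < \<epsilon>")
      case True
      then show ?thesis using \<eta> by (intro exI[of _ z]) simp
    next
      case False
      define c where "c = lower_modulus w (mat_sub M z)"
      have c: "\<epsilon> \<le> c" using False by (simp add: c_def)
      note Mz = bounded_by_mat_sub[OF M, of z]
      have "cmod z \<le> K + \<epsilon> + 1"
        using lower_modulus_ge_norm[OF w M, of z] lt \<delta>(2) by (simp add: K_def)
      then have \<kappa>z: "real_of_int (2 * w + 1) * (\<alpha> + cmod z) \<le> \<kappa>"
        unfolding \<kappa>_def using w by (intro mult_left_mono) auto
      have pos: "0 < lower_modulus w (mat_sub M z)" using c \<epsilon> by (simp add: c_def)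
      have "lower_modulus w (mat_sub M z) < \<epsilon> + 2 * \<delta>" using lt \<delta>(1) by simp
      from near_minimizer[OF w Mz pos this] obtain x r s where
        x: "x \<in> l2N" "x \<noteq> (\<lambda>_. 0)" "l2norm (band_app w (mat_sub M z) x) \<le> (\<epsilon> + 2 * \<delta>) * l2norm x"
        and r: "r \<in> l2N" "band_app w (mat_sub M z) r = x" and s: "s \<in> l2N" "band_app w (mat_sub M z) s = r"
        by blast
      have "l2norm x \<le> real_of_int (2 * w + 1) * (\<alpha> + cmod z) * l2norm r"
        using band_app_l2(2)[OF w Mz r(1)] by (simp add: r(2))
      also have "\<dots> \<le> \<kappa> * l2norm r" by (rule mult_right_mono[OF \<kappa>z]) simp
      finally have "l2norm x \<le> \<kappa> * l2norm r" .
      from lower_bound_descent[OF w Mz pos lower_bound_lower_modulus(1)[OF w Mz] x r s \<kappa> this less_imp_le[OF \<rho>(1)]]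
      obtain \<omega> where \<omega>: "cmod \<omega> = \<rho>"
        and le: "lower_modulus w (mat_sub (mat_sub M z) \<omega>) * S \<le> \<epsilon> + 2 * \<delta> + \<rho>^3 / c^2"
        unfolding S_def c_def by blast
      have "\<rho>^3 / c^2 \<le> \<rho>^3 / \<epsilon>^2"
        using c \<epsilon> \<rho>(1) by (intro divide_left_mono power_mono mult_pos_pos) auto
      also have "\<dots> = \<epsilon> * u" using \<epsilon> by (simp add: u_def field_simps power2_eq_square power3_eq_cube)
      finally have "lower_modulus w (mat_sub M (z + \<omega>)) * S \<le> \<epsilon> + 2 * \<delta> + \<epsilon> * u"
        using le by (simp add: mat_sub_mat_sub)
      also have "\<dots> < \<epsilon> * S" using \<delta>(1) \<delta>3 by (simp add: algebra_simps)
      finally have "lower_modulus w (mat_sub M (z + \<omega>)) < \<epsilon>" using S by simp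
      then show ?thesis using \<omega> \<rho>(2) by (intro exI[of _ "z + \<omega>"]) (simp add: dist_norm)
    qed
  qed
qed

section \<open>Normal band matrices and the distance to the spectrum\<close>

definition normal_matrix :: "int \<Rightarrow> (int \<Rightarrow> int \<Rightarrow> complex) \<Rightarrow> bool" where
  "normal_matrix w M \<longleftrightarrow> (\<forall>x\<in>l2N. band_app w M (band_app w (mat_adj M) x) = band_app w (mat_adj M) (band_app w M x))"

lemma normal_matrix_mat_sub:
  assumes w: "0 \<le> w" and M: "bounded_by \<alpha> M" and n: "normal_matrix w M"
  shows "normal_matrix w (mat_sub M z)"
  unfolding normal_matrix_def mat_adj_mat_sub
proof
  fix x assume x: "x \<in> l2N"
  have M': "bounded_by \<alpha> (mat_adj M)" using M by simp
  have S: "band_app w (mat_sub M z) x \<in> l2N" "band_app w (mat_sub (mat_adj M) (cnj z)) x \<in> l2N"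
    using band_app_l2(1)[OF w bounded_by_mat_sub[OF M] x] band_app_l2(1)[OF w bounded_by_mat_sub[OF M'] x] by auto
  have "band_app w M (band_app w (mat_adj M) x) = band_app w (mat_adj M) (band_app w M x)"
    using n x by (simp add: normal_matrix_def)
  then show "band_app w (mat_sub M z) (band_app w (mat_sub (mat_adj M) (cnj z)) x)
      = band_app w (mat_sub (mat_adj M) (cnj z)) (band_app w (mat_sub M z) x)"
    unfolding band_app_mat_sub[OF w S(1)] band_app_mat_sub[OF w S(2)]
    by (simp add: band_app_mat_sub[OF w x] band_app_diff band_app_scale algebra_simps)
qed

lemma normal_matrix_norm:
  assumes w: "0 \<le> w" and M: "bounded_by \<alpha> M" and n: "normal_matrix w M" and x: "x \<in> l2N"
  shows "l2norm (band_app w (mat_adj M) x) = l2norm (band_app w M x)"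
proof -
  have M': "bounded_by \<alpha> (mat_adj M)" using M by simp
  note A = band_app_l2(1)[OF w M x] and A' = band_app_l2(1)[OF w M' x]
  have "complex_of_real ((l2norm (band_app w (mat_adj M) x))^2) = l2inner x (band_app w M (band_app w (mat_adj M) x))"
    using l2inner_band_app[OF M' x A', of w] by (simp add: l2inner_self[OF l2N_l2Z[OF A']])
  also have "\<dots> = l2inner x (band_app w (mat_adj M) (band_app w M x))"
    using n x by (simp add: normal_matrix_def)
  also have "\<dots> = complex_of_real ((l2norm (band_app w M x))^2)"
    using l2inner_band_app[OF M x A, of w] by (simp add: l2inner_self[OF l2N_l2Z[OF A]])
  finally have "(l2norm (band_app w (mat_adj M) x))^2 = (l2norm (band_app w M x))^2"
    by (simp only: of_real_eq_iff)
  then show ?thesis by (simp add: power2_eq_iff_nonneg)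
qed

text \<open>Normality gives \<open>\<parallel>B^* z\<parallel> = \<parallel>B z\<parallel> \<le> a
  \<parallel>z\<parallel>\<close>, so \<open>\<parallel>z\<parallel>^2 = <r, B^* z>\<close> allows
  \<open>\<kappa> = a\<close>, close to the lower modulus. With \<open>\<rho>\<close> proportional
  to it as well, gain and error are scale invariant, hence the fixed factor.\<close>

lemma normal_matrix_descent:
  assumes w: "0 \<le> w" and M: "bounded_by \<alpha> M" and n: "normal_matrix w M" and pos: "0 < lower_modulus w M"
  shows "\<exists>\<omega>. cmod \<omega> = lower_modulus w M / 4 \<and> lower_modulus w (mat_sub M \<omega>) \<le> 99 / 100 * lower_modulus w M"
proof -
  define c where "c = lower_modulus w M"
  define a where "a = 1001 / 1000 * c"
  have c: "0 < c" using pos by (simp add: c_def)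
  have a: "0 < a" using c by (simp add: a_def)
  have "lower_modulus w M < a" using c by (simp add: a_def c_def)
  from near_minimizer[OF w M pos this] obtain z r s where
    z: "z \<in> l2N" "z \<noteq> (\<lambda>_. 0)" "l2norm (band_app w M z) \<le> a * l2norm z"
    and r: "r \<in> l2N" "band_app w M r = z" and s: "s \<in> l2N" "band_app w M s = r" by blast
  have z': "band_app w (mat_adj M) z \<in> l2N" using band_app_l2(1)[OF w _ z(1), of \<alpha>] M by simp
  have "complex_of_real ((l2norm z)^2) = l2inner r (band_app w (mat_adj M) z)"
    using l2inner_band_app[OF M r(1) z(1), of w] by (simp add: r(2) l2inner_self[OF l2N_l2Z[OF z(1)]])
  then have "cmod (complex_of_real ((l2norm z)^2)) \<le> l2norm r * l2norm (band_app w (mat_adj M) z)"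
    using cmod_l2inner_le[OF l2N_l2Z[OF r(1)] l2N_l2Z[OF z']] by simp
  also have "\<dots> \<le> l2norm r * (a * l2norm z)"
    unfolding normal_matrix_norm[OF w M n z(1)] by (rule mult_left_mono[OF z(3)]) simp
  finally have "l2norm z * l2norm z \<le> (a * l2norm r) * l2norm z"
    unfolding norm_of_real abs_power2 power2_eq_square by (simp only: mult_ac)
  then have zr: "l2norm z \<le> a * l2norm r"
    using l2norm_pos[OF l2N_l2Z[OF z(1)] z(2)] by simp
  from lower_bound_descent[OF w M pos lower_bound_lower_modulus(1)[OF w M] z r s a zr, of "c / 4"]
  obtain \<omega> where \<omega>: "cmod \<omega> = c / 4"
    and le: "lower_modulus w (mat_sub M \<omega>) * sqrt (1 + (c / 4)^2 / a^2) \<le> a + (c / 4)^3 / c^2"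
    using c unfolding c_def[symmetric] by auto
  \<comment> \<open>With \<open>a = 1.001 c\<close> and \<open>\<rho> = c / 4\<close> the gain is at
    least 1.03, the right-hand side is \<open>(1.001 + 1/64) c\<close>, below
    \<open>1.017 c\<close>, and \<open>1.017 / 1.03 < 0.99\<close>.\<close>
  have "(103 / 100)^2 \<le> 1 + (c / 4)^2 / a^2"
    using c by (simp add: a_def field_simps power2_eq_square)
  then have "103 / 100 \<le> sqrt (1 + (c / 4)^2 / a^2)"
    by (rule real_le_rsqrt)
  then have "lower_modulus w (mat_sub M \<omega>) * (103 / 100) \<le> lower_modulus w (mat_sub M \<omega>) * sqrt (1 + (c / 4)^2 / a^2)"
    by (rule mult_left_mono) (rule lower_modulus_nonneg[OF w bounded_by_mat_sub[OF M]])
  also note le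
  also have "a + (c / 4)^3 / c^2 = (1001 / 1000 + 1 / 64) * c"
    using c by (simp add: a_def field_simps power2_eq_square power3_eq_cube)
  finally have "lower_modulus w (mat_sub M \<omega>) \<le> 99 / 100 * c" using c by simp
  then show ?thesis using \<omega> by (auto simp: c_def)
qed

text \<open>A minimizer of \<open>z' \<mapsto> lower_modulus w (mat_sub M z') + dist z' z / 50\<close> must be a zero of the first
  summand, since otherwise the previous lemma decreases the sum.\<close>

lemma normal_matrix_spectrum_near:
  assumes w: "0 \<le> w" and M: "bounded_by \<alpha> M" and n: "normal_matrix w M"
  shows "\<exists>z'. lower_modulus w (mat_sub M z') = 0 \<and> dist z' z \<le> 50 * lower_modulus w (mat_sub M z)"
proof -
  define \<mu> where "\<mu> = (\<lambda>z. lower_modulus w (mat_sub M z))"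
  define F where "F = (\<lambda>z'. \<mu> z' + dist z' z / 50)"
  have \<mu>0: "0 \<le> \<mu> z" for z unfolding \<mu>_def by (rule lower_modulus_nonneg[OF w bounded_by_mat_sub[OF M]])
  have "continuous_on UNIV \<mu>"
    by (rule lipschitz_on_continuous_on[of 1])
      (use lower_modulus_lipschitz[OF w M] in \<open>auto simp: lipschitz_on_def dist_norm \<mu>_def\<close>)
  then have "continuous_on (cball z (50 * \<mu> z)) \<mu>"
    by (rule continuous_on_subset) simp
  then have cont: "continuous_on (cball z (50 * \<mu> z)) F"
    unfolding F_def by (intro continuous_intros) auto
  have "cball z (50 * \<mu> z) \<noteq> {}" using \<mu>0[of z] by simp
  from continuous_attains_inf[OF compact_cball this cont]
  obtain y where y: "y \<in> cball z (50 * \<mu> z)" and inf: "\<And>y'. y' \<in> cball z (50 * \<mu> z) \<Longrightarrow> F y \<le> F y'"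
    by blast
  \<comment> \<open>Outside the disc the penalty alone exceeds \<open>\<mu> z = F z\<close>, so the
    minimum over the disc is global.\<close>
  have min: "F y \<le> F y'" for y'
  proof (cases "y' \<in> cball z (50 * \<mu> z)")
    case False
    have "F y \<le> F z" using inf \<mu>0[of z] by simp
    also have "F z \<le> F y'" using False \<mu>0[of y'] by (simp add: F_def dist_commute)
    finally show ?thesis .
  qed (rule inf)
  have "\<mu> y = 0"
  proof (rule ccontr)
    assume "\<mu> y \<noteq> 0"
    then have pos: "0 < \<mu> y" using \<mu>0[of y] by simp
    from normal_matrix_descent[OF w bounded_by_mat_sub[OF M] normal_matrix_mat_sub[OF w M n] pos[unfolded \<mu>_def]]
    obtain \<omega> where \<omega>: "cmod \<omega> = \<mu> y / 4" "\<mu> (y + \<omega>) \<le> 99 / 100 * \<mu> y"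
      unfolding \<mu>_def mat_sub_mat_sub by blast
    \<comment> \<open>The move costs at most \<open>\<mu> y / 200\<close> in the penalty and gains
      at least \<open>\<mu> y / 100\<close>.\<close>
    have "dist (y + \<omega>) z \<le> dist y z + \<mu> y / 4"
      using dist_triangle[of "y + \<omega>" z y] \<omega>(1) by (simp add: dist_norm)
    with \<omega>(2) pos have "F (y + \<omega>) < F y" by (simp add: F_def)
    with min[of "y + \<omega>"] show False by simp
  qed
  moreover have "dist y z \<le> 50 * \<mu> z" using y by (simp add: dist_commute)
  ultimately show ?thesis by (auto simp: \<mu>_def)
qed

section \<open>The extended Hausdorff distance\<close>

lemma hausdistE_nonneg: "0 \<le> hausdistE X Y"
proof (cases "X = {} \<or> Y = {}")
  case False
  then obtain x where x: "x \<in> X" by blast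
  have "0 \<le> (SUP x\<in>X. ereal (infdist x Y))"
    by (rule SUP_upper2[OF x]) (simp add: infdist_nonneg)
  then show ?thesis using False by (simp add: hausdistE_def le_max_iff_disj)
qed (auto simp: hausdistE_def)

text \<open>The two conditions force \<open>X\<close> and \<open>Y\<close> to be empty together, so
  the infinite value for exactly one empty set does not occur.\<close>

lemma hausdistE_le:
  assumes "0 \<le> \<eta>" "\<And>x. x \<in> X \<Longrightarrow> \<exists>y\<in>Y. dist x y \<le> \<eta>" "\<And>y. y \<in> Y \<Longrightarrow> \<exists>x\<in>X. dist y x \<le> \<eta>"
  shows "hausdistE X Y \<le> ereal \<eta>"
proof -
  have "infdist x Y \<le> \<eta>" if "x \<in> X" for x
    using assms(2)[OF that] infdist_le2 by blast
  moreover have "infdist y X \<le> \<eta>" if "y \<in> Y" for y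
    using assms(3)[OF that] infdist_le2 by blast
  ultimately show ?thesis
    using assms by (auto simp: hausdistE_def intro!: SUP_least)
qed

lemma hausdistE_tendsto_0:
  assumes "\<And>\<eta>. 0 < \<eta> \<Longrightarrow> eventually (\<lambda>m. (\<forall>x\<in>X m. \<exists>y\<in>Y. dist x y \<le> \<eta>)
    \<and> (\<forall>y\<in>Y. \<exists>x\<in>X m. dist y x \<le> \<eta>)) sequentially"
  shows "(\<lambda>m. hausdistE (X m) Y) \<longlonglongrightarrow> 0"
proof (rule order_tendstoI)
  fix a :: ereal assume "a < 0"
  then show "eventually (\<lambda>m. a < hausdistE (X m) Y) sequentially"
    using hausdistE_nonneg less_le_trans by (intro always_eventually) blast
next
  fix a :: ereal assume "0 < a"
  then obtain \<eta> where \<eta>: "0 < ereal \<eta>" "ereal \<eta> < a" using ereal_dense2 by blast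
  from \<eta>(1) have "0 < \<eta>" by simp
  from assms[OF this] show "eventually (\<lambda>m. hausdistE (X m) Y < a) sequentially"
  proof eventually_elim
    case (elim m)
    then have "hausdistE (X m) Y \<le> ereal \<eta>" using \<open>0 < \<eta>\<close> by (intro hausdistE_le) auto
    then show ?case using \<eta>(2) by (rule le_less_trans)
  qed
qed

section \<open>Generalized Schroedinger operators\<close>

text \<open>The part commuting with the shift is a Toeplitz matrix. In \<open>S^\<gamma> M_u\<close>
  the multiplication comes first, so the potential is indexed by the column
  \<open>j\<close>.\<close>

definition schroedinger_mat :: "(int \<Rightarrow> complex) \<Rightarrow> int \<Rightarrow> (nat \<Rightarrow> complex) \<Rightarrow> int \<Rightarrow> int \<Rightarrow> complex" where
  "schroedinger_mat c \<gamma> u = (\<lambda>i j. c (i - j) + (if i - j = \<gamma> then ext_seq u j else 0))"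

lemma bounded_by_schroedinger_mat:
  assumes "\<And>k. cmod (c k) \<le> C" "\<And>n. 1 \<le> n \<Longrightarrow> cmod (u n) \<le> B" "0 \<le> B"
  shows "bounded_by (C + B) (schroedinger_mat c \<gamma> u)"
  unfolding bounded_by_def
proof (intro allI)
  fix i j
  have "cmod (ext_seq u j) \<le> B"
    using assms(2)[of "nat j"] assms(3) by (auto simp: ext_seq_def)
  then have "cmod (if i - j = \<gamma> then ext_seq u j else 0) \<le> B" using assms(3) by simp
  then show "cmod (schroedinger_mat c \<gamma> u i j) \<le> C + B"
    unfolding schroedinger_mat_def using assms(1) norm_triangle_mono by blast
qed

text \<open>The rows and columns touched by a window reach \<open>w\<close> beyond it on both sides,
  hence the length \<open>D + 2 w\<close>. For \<open>p > w\<close> that stretch is a subword of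
  \<open>u\<close> and occurs somewhere in \<open>u'\<close>; for \<open>p \<le> w\<close> its
  positive part lies within the first \<open>N\<close> letters, where the sequences agree.\<close>

lemma words_window:
  assumes N: "N = D + 2 * nat w" and w: "0 \<le> w"
    and words: "words N u \<subseteq> words N u'" and agree: "\<And>k. 1 \<le> k \<Longrightarrow> k \<le> N \<Longrightarrow> u' k = u k"
    and p: "1 \<le> p"
  shows "\<exists>q. (q = p \<or> w < p \<and> w < q) \<and>
    (\<forall>l. 1 \<le> l \<longrightarrow> p - w \<le> l \<longrightarrow> l < p + int D + w \<longrightarrow> ext_seq u' (l + (q - p)) = ext_seq u l)"
proof (cases "w < p")
  case False
  have "ext_seq u' l = ext_seq u l" if "1 \<le> l" "l < p + int D + w" for l
    using agree[of "nat l"] that False w by (simp add: ext_seq_def N)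
  then show ?thesis by (intro exI[of _ p]) simp
next
  case True
  define s where "s = nat (p - w)"
  have s: "1 \<le> s" "int s = p - w" using True by (auto simp: s_def)
  then have "map u [s..<s + N] \<in> words N u'" using words by (auto simp: words_def)
  then obtain k where k: "1 \<le> k" and eq: "map u [s..<s + N] = map u' [k..<k + N]"
    by (auto simp: words_def)
  have eq': "u (s + i) = u' (k + i)" if "i < N" for i
    using arg_cong[OF eq, of "\<lambda>xs. xs ! i"] that by simp
  define q where "q = int k + w"
  have "ext_seq u' (l + (q - p)) = ext_seq u l" if l: "p - w \<le> l" "l < p + int D + w" for l
  proof -
    define i where "i = nat (l - (p - w))"
    have i: "l = int (s + i)" "l + (q - p) = int (k + i)" "i < N"
      using l s w by (auto simp: i_def q_def N)
    show ?thesis unfolding i(2) unfolding i(1)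
      using eq'[OF i(3)] s k by (simp add: ext_seq_def del: of_nat_add)
  qed
  moreover have "w < q" using k by (simp add: q_def)
  ultimately show ?thesis using True by blast
qed

text \<open>Inclusion of words carries lower bounds from \<open>u'\<close> to \<open>u\<close>;
  exchanging the two sequences gives the opposite estimate. The parameter \<open>z\<close> sits on
  the diagonal, so the loss does not depend on it.\<close>

lemma lower_modulus_schroedinger_mat_le:
  assumes w: "0 \<le> w" and D: "1 \<le> D" and N: "N = D + 2 * nat w"
    and M: "bounded_by \<alpha> (schroedinger_mat c \<gamma> u)" "bounded_by \<alpha> (schroedinger_mat c \<gamma> u')"
    and words: "words N u \<subseteq> words N u'" and agree: "\<And>k. 1 \<le> k \<Longrightarrow> k \<le> N \<Longrightarrow> u' k = u k"
  shows "lower_modulus w (mat_sub (schroedinger_mat c \<gamma> u') z) - real_of_int (2 * w + 1) * (\<alpha> * sqrt (2 * w)) / sqrt D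
    \<le> lower_modulus w (mat_sub (schroedinger_mat c \<gamma> u) z)"
proof -
  let ?M = "mat_sub (schroedinger_mat c \<gamma> u) z" and ?M' = "mat_sub (schroedinger_mat c \<gamma> u') z"
  note B = bounded_by_mat_sub[OF M(1), of z] and B' = bounded_by_mat_sub[OF M(2), of z]
  \<comment> \<open>The parameter \<open>f\<close> treats the matrix and its adjoint at once: an
    entry depends on \<open>i - j\<close>, on \<open>z\<close> and on one letter, taken at the
    column or at the row, both within \<open>w\<close> of the window.\<close>
  have loc: "\<exists>q. (q = p \<or> w < p \<and> w < q) \<and>
      (\<forall>i j. 1 \<le> i \<longrightarrow> p \<le> j \<longrightarrow> j < p + int D \<longrightarrow> \<bar>i - j\<bar> \<le> w \<longrightarrow>
        f ?M' (i + (q - p)) (j + (q - p)) = f ?M i j)"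
    if p: "1 \<le> p" and f: "f = id \<or> f = mat_adj" for p f
  proof -
    obtain q where q: "q = p \<or> w < p \<and> w < q"
      and eq: "\<And>l. 1 \<le> l \<Longrightarrow> p - w \<le> l \<Longrightarrow> l < p + int D + w \<Longrightarrow> ext_seq u' (l + (q - p)) = ext_seq u l"
      using words_window[OF N w words agree p] by blast
    have "f ?M' (i + (q - p)) (j + (q - p)) = f ?M i j"
      if "1 \<le> i" "p \<le> j" "j < p + int D" "\<bar>i - j\<bar> \<le> w" for i j
      using eq[of i] eq[of j] that p w f by (auto simp: mat_sub_def schroedinger_mat_def mat_adj_def)
    with q show ?thesis by blast
  qed
  let ?c = "lower_modulus w ?M'"
  have wb: "window_bound w ?M (int D) ?c"
    by (rule window_bound_transfer[OF window_boundI[OF lower_bound_lower_modulus(1)[OF w B']]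
          loc[OF _ disjI1[OF refl], unfolded id_apply] w])
  have wb': "window_bound w (mat_adj ?M) (int D) ?c"
    by (rule window_bound_transfer[OF window_boundI[OF lower_bound_lower_modulus(2)[OF w B']]
          loc[OF _ disjI2[OF refl]] w])
  have off: "cmod (?M i j) \<le> \<alpha>" "cmod (mat_adj ?M i j) \<le> \<alpha>" if "i \<noteq> j" for i j
    using that M(1) by (auto simp: mat_sub_def mat_adj_def bounded_by_def)
  have D': "1 \<le> int D" using D by simp
  have B'': "bounded_by (\<alpha> + cmod z) (mat_adj ?M)" using B by simp
  show ?thesis
    using lower_bound_of_window[OF w D' B off(1) wb] lower_bound_of_window[OF w D' B'' off(2) wb']
    by (simp add: le_lower_modulus_iff[OF w B])
qed

section \<open>From half-axis operators to matrices\<close>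

lemma band_op_shift_invariant:
  assumes "\<forall>x\<in>l2Z. band_op w a (shift x) = shift (band_op w a x)" "k \<in> {-int w..int w}"
  shows "a k n = a k 0"
proof -
  have step: "a k n = a k (n - 1)" for n
  proof -
    \<comment> \<open>The unit vector is placed so that only the diagonal \<open>k\<close>
      contributes to row \<open>n - 1\<close>, and after the shift only that diagonal to row
      \<open>n\<close>.\<close>
    define x where "x = (\<lambda>i. if i = n - 1 - k then 1 else 0 :: complex)"
    have "x \<in> l2Z" by (rule l2Z_finite[of "{n - 1 - k}"]) (auto simp: x_def)
    then have "band_op w a (shift x) n = band_op w a x (n - 1)"
      using assms(1) by (simp add: shift_def)
    moreover have "band_op w a (shift x) n = (\<Sum>k'\<in>{-int w..int w}. if k' = k then a k n else 0)"
      unfolding band_op_def by (rule sum.cong) (auto simp: mult_op_def shift_pow_def shift_def x_def)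
    moreover have "band_op w a x (n - 1) = (\<Sum>k'\<in>{-int w..int w}. if k' = k then a k (n - 1) else 0)"
      unfolding band_op_def by (rule sum.cong) (auto simp: mult_op_def shift_pow_def x_def)
    ultimately show ?thesis using assms(2) by simp
  qed
  show ?thesis
  proof (induction n rule: int_induct[where k = 0])
    case (step1 i)
    then show ?case using step[of "i + 1"] by simp
  next
    case (step2 i)
    then show ?case using step[of i] by simp
  qed simp
qed

text \<open>The width \<open>W\<close> makes room for the diagonal \<open>\<gamma>\<close>, which
  may lie outside the band of \<open>L\<close>; the coefficients \<open>c\<close> are therefore
  padded by zeros.\<close>

lemma Hplus_eq_band_app:
  fixes w :: nat
  assumes w: "\<bar>\<gamma>\<bar> \<le> W" "int w \<le> W"
    and a: "\<And>k n. k \<in> {-int w..int w} \<Longrightarrow> a k n = c k" and c: "\<And>k. k \<notin> {-int w..int w} \<Longrightarrow> c k = 0"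
    and x: "x \<in> l2N"
  shows "Hplus (band_op w a) \<gamma> u x = band_app W (schroedinger_mat c \<gamma> u) x"
proof
  fix n
  have px: "projN x = x" using l2N_nonpos[OF x] by (auto simp: projN_def)
  show "Hplus (band_op w a) \<gamma> u x n = band_app W (schroedinger_mat c \<gamma> u) x n"
  proof (cases "1 \<le> n")
    case True
    have "band_op w a x n = (\<Sum>k\<in>{-int w..int w}. c k * x (n - k))"
      unfolding band_op_def by (rule sum.cong) (auto simp: mult_op_def shift_pow_def a)
    also have "\<dots> = (\<Sum>k\<in>{-W..W}. c k * x (n - k))"
      by (rule sum.mono_neutral_left) (use w c in auto)
    also have "\<dots> = (\<Sum>d\<in>{-W..W}. c (- d) * x (n + d))"
      by (rule sum.reindex_bij_witness[where i = uminus and j = uminus]) auto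
    finally have 1: "band_op w a x n = (\<Sum>d\<in>{-W..W}. c (- d) * x (n + d))" .
    have "(\<Sum>d\<in>{-W..W}. (if - d = \<gamma> then ext_seq u (n + d) else 0) * x (n + d))
        = (\<Sum>d\<in>{-W..W}. if d = - \<gamma> then ext_seq u (n - \<gamma>) * x (n - \<gamma>) else 0)"
      by (rule sum.cong) auto
    also have "\<dots> = ext_seq u (n - \<gamma>) * x (n - \<gamma>)"
      using w(1) by (simp add: abs_le_iff)
    finally have 2: "(\<Sum>d\<in>{-W..W}. (if - d = \<gamma> then ext_seq u (n + d) else 0) * x (n + d))
        = ext_seq u (n - \<gamma>) * x (n - \<gamma>)" .
    have "Hplus (band_op w a) \<gamma> u x n = band_op w a x n + ext_seq u (n - \<gamma>) * x (n - \<gamma>)"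
      using True by (simp add: Hplus_def compress_def px) (simp add: projN_def H_op_def shift_pow_def mult_op_def)
    also have "\<dots> = band_app W (schroedinger_mat c \<gamma> u) x n"
      unfolding 1 2[symmetric] using True by (simp add: band_app_def schroedinger_mat_def distrib_right sum.distrib)
    finally show ?thesis .
  qed (simp add: Hplus_def compress_def projN_def band_app_def)
qed

text \<open>Adjoints are unique: testing against unit vectors shows that any witness in
  \<open>normalN\<close> agrees on \<open>l2N\<close> with the conjugate transpose.\<close>

lemma normalN_band_app:
  assumes M: "bounded_by \<alpha> M" "0 \<le> w" and T: "\<And>x. x \<in> l2N \<Longrightarrow> T x = band_app w M x" and n: "normalN T"
  shows "normal_matrix w M"
proof -
  from n obtain T' where T': "\<And>x. x \<in> l2N \<Longrightarrow> T' x \<in> l2N"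
    and adjoint: "\<And>x y. x \<in> l2N \<Longrightarrow> y \<in> l2N \<Longrightarrow> l2inner (T x) y = l2inner x (T' y)"
    and comm: "\<And>x. x \<in> l2N \<Longrightarrow> T (T' x) = T' (T x)"
    unfolding normalN_def by blast
  have M': "bounded_by \<alpha> (mat_adj M)" using M by simp
  have "T' y = band_app w (mat_adj M) y" if y: "y \<in> l2N" for y
  proof
    fix i
    have My: "band_app w (mat_adj M) y \<in> l2N" by (rule band_app_l2(1)[OF M(2) M' y])
    show "T' y i = band_app w (mat_adj M) y i"
    proof (cases "1 \<le> i")
      case True
      let ?d = "\<lambda>k::int. if k = i then 1 else 0 :: complex"
      have d: "?d \<in> l2N" by (rule l2N_finite[of "{i}"]) (use True in auto)
      have "l2inner ?d (T' y) = l2inner ?d (band_app w (mat_adj M) y)"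
        using adjoint[OF d y] l2inner_band_app[OF M(1) d y, of w] T[OF d] by simp
      then show ?thesis by (simp add: l2inner_delta)
    next
      case False
      then show ?thesis using l2N_nonpos[OF T'[OF y]] l2N_nonpos[OF My] by simp
    qed
  qed
  then show ?thesis
    unfolding normal_matrix_def using comm T T' band_app_l2(1)[OF M(2,1)] by metis
qed

text \<open>The window length \<open>D\<close> is fixed first, from \<open>e\<close>,
  \<open>w\<close> and \<open>\<alpha>\<close>. Only words of length \<open>N\<close> and the first
  \<open>N\<close> letters are then compared, so the threshold for \<open>m\<close> does not involve
  \<open>z\<close>.\<close>

lemma lower_modulus_schroedinger_mat_uniform:
  assumes w: "0 \<le> w" and M: "bounded_by \<alpha> (schroedinger_mat c \<gamma> b)"
    and Ms: "\<And>m. 1 \<le> m \<Longrightarrow> bounded_by \<alpha> (schroedinger_mat c \<gamma> (bs m))"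
    and words: "\<forall>N\<ge>1. \<exists>m0\<ge>1. \<forall>m\<ge>m0. words N (bs m) = words N b"
    and agree: "\<And>n. 1 \<le> n \<Longrightarrow> eventually (\<lambda>m. bs m n = b n) sequentially"
    and e: "0 < e"
  shows "eventually (\<lambda>m. \<forall>z. \<bar>lower_modulus w (mat_sub (schroedinger_mat c \<gamma> (bs m)) z) - lower_modulus w (mat_sub (schroedinger_mat c \<gamma> b) z)\<bar> \<le> e) sequentially"
proof -
  define E where "E = real_of_int (2 * w + 1) * (\<alpha> * sqrt (2 * w))"
  obtain d where d: "(E / e)^2 < real d" using reals_Archimedean2 by blast
  define D where "D = Suc d"
  have "(E / e)^2 \<le> real D" using d by (simp add: D_def)
  then have "E / e \<le> sqrt D" by (rule real_le_rsqrt)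
  then have ED: "E / sqrt D \<le> e" using e by (simp add: field_simps D_def)
  have D: "1 \<le> D" by (simp add: D_def)
  define N where "N = D + 2 * nat w"
  have "1 \<le> N" using D by (simp add: N_def)
  then obtain m0 where m0: "\<And>m. m0 \<le> m \<Longrightarrow> words N (bs m) = words N b" using words by blast
  have "eventually (\<lambda>m. \<forall>k\<in>{1..N}. bs m k = b k) sequentially"
    by (rule eventually_ball_finite) (use agree in auto)
  then show ?thesis
    using eventually_ge_at_top[of m0] eventually_ge_at_top[of 1]
  proof eventually_elim
    case (elim m)
    show ?case
    proof
      fix z
      have "lower_modulus w (mat_sub (schroedinger_mat c \<gamma> (bs m)) z) - E / sqrt D \<le> lower_modulus w (mat_sub (schroedinger_mat c \<gamma> b) z)"
        unfolding E_def by (rule lower_modulus_schroedinger_mat_le[OF w D N_def M Ms]) (use elim m0[of m] in auto)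
      moreover have "lower_modulus w (mat_sub (schroedinger_mat c \<gamma> b) z) - E / sqrt D \<le> lower_modulus w (mat_sub (schroedinger_mat c \<gamma> (bs m)) z)"
        unfolding E_def by (rule lower_modulus_schroedinger_mat_le[OF w D N_def Ms M]) (use elim m0[of m] in auto)
      ultimately show "\<bar>lower_modulus w (mat_sub (schroedinger_mat c \<gamma> (bs m)) z) - lower_modulus w (mat_sub (schroedinger_mat c \<gamma> b) z)\<bar> \<le> e"
        using ED by linarith
    qed
  qed
qed

lemma resolvent_norm_eq_lower_modulus:
  assumes w: "0 \<le> w" and M: "bounded_by \<alpha> M" and T: "\<And>x. x \<in> l2N \<Longrightarrow> T x = band_app w M x"
  shows "resolvent_norm T z = inverse (ereal (lower_modulus w (mat_sub M z)))"
    and "z \<in> spectrumN T \<longleftrightarrow> lower_modulus w (mat_sub M z) = 0"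
    and "0 < \<epsilon> \<Longrightarrow> z \<in> pseudospectrumN T \<epsilon> \<longleftrightarrow> lower_modulus w (mat_sub M z) < \<epsilon>"
proof -
  have eq: "shifted T z x = band_app w (mat_sub M z) x" if "x \<in> l2N" for x
    using that T by (simp add: shifted_def band_app_mat_sub[OF w])
  note Mz = bounded_by_mat_sub[OF M, of z]
  have nonneg: "0 \<le> lower_modulus w (mat_sub M z)" by (rule lower_modulus_nonneg[OF w Mz])
  show res: "resolvent_norm T z = inverse (ereal (lower_modulus w (mat_sub M z)))"
    unfolding resolvent_norm_def using inv_norm_cong[OF eq] inv_norm_band_app[OF w Mz] by simp
  show "z \<in> spectrumN T \<longleftrightarrow> lower_modulus w (mat_sub M z) = 0"
    unfolding spectrumN_def using invertibleN_cong[OF eq] lower_modulus_pos_iff_invertible[OF w Mz] nonneg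
    by auto
  show "z \<in> pseudospectrumN T \<epsilon> \<longleftrightarrow> lower_modulus w (mat_sub M z) < \<epsilon>" if "0 < \<epsilon>"
    using that nonneg
    by (cases "lower_modulus w (mat_sub M z) = 0") (auto simp: pseudospectrumN_def res field_simps)
qed

theorem theorem4p12:
  fixes Alph :: "complex set"
    and L :: "(int \<Rightarrow> complex) \<Rightarrow> (int \<Rightarrow> complex)"
    and \<gamma> :: int
    and b :: "nat \<Rightarrow> complex"
    and bs :: "nat \<Rightarrow> nat \<Rightarrow> complex"
  assumes "finite Alph" and "Alph \<noteq> {}"
    and "is_band_op L"
    and "\<forall>x\<in>l2Z. L (shift x) = shift (L x)"
    and "\<forall>n\<ge>1. b n \<in> Alph"
    and "\<forall>m\<ge>1. \<forall>n\<ge>1. bs m n \<in> Alph"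
    and "\<forall>N\<ge>1. \<exists>m0\<ge>1. \<forall>m\<ge>m0. words N (bs m) = words N b"
    and "\<forall>n\<ge>1. (\<lambda>m. bs m n) \<longlonglongrightarrow> b n"
  shows "(\<forall>z. (\<lambda>m. resolvent_norm (Hplus L \<gamma> (bs m)) z)
                \<longlonglongrightarrow> resolvent_norm (Hplus L \<gamma> b) z)
    \<and> (\<forall>\<epsilon>>0. (\<lambda>m. hausdistE (pseudospectrumN (Hplus L \<gamma> (bs m)) \<epsilon>)
                                  (pseudospectrumN (Hplus L \<gamma> b) \<epsilon>)) \<longlonglongrightarrow> 0)
    \<and> ((\<forall>m\<ge>1. normalN (Hplus L \<gamma> (bs m))) \<and> normalN (Hplus L \<gamma> b) \<longrightarrow>
         (\<lambda>m. hausdistE (spectrumN (Hplus L \<gamma> (bs m))) (spectrumN (Hplus L \<gamma> b))) \<longlonglongrightarrow> 0)"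
proof -
  obtain w0 a where L: "L = band_op w0 a"
    using assms(3) unfolding is_band_op_def by blast
  \<comment> \<open>\<open>L\<close> does not determine \<open>a k\<close> for \<open>k\<close>
    beyond the band, so \<open>c\<close> is set to 0 there.\<close>
  define c where "c = (\<lambda>k. if k \<in> {-int w0..int w0} then a k 0 else 0)"
  define w where "w = max \<bar>\<gamma>\<bar> (int w0)"
  have w: "0 \<le> w" by (simp add: w_def)
  have ac: "a k n = c k" if "k \<in> {-int w0..int w0}" for k n
    unfolding c_def using band_op_shift_invariant[OF assms(4)[unfolded L] that] that by simp
  have T: "Hplus L \<gamma> u x = band_app w (schroedinger_mat c \<gamma> u) x" if "x \<in> l2N" for u x
    unfolding L by (rule Hplus_eq_band_app[OF _ _ ac _ that]) (auto simp: w_def c_def)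
  have "finite (range c)"
    by (rule finite_subset[of _ "insert 0 ((\<lambda>k. a k 0) ` {-int w0..int w0})"]) (auto simp: c_def)
  then have "bounded (range c)" by (rule finite_imp_bounded)
  then obtain C where C: "\<And>k. cmod (c k) \<le> C" by (auto simp: bounded_iff)
  obtain B where B: "0 < B" "\<And>x. x \<in> Alph \<Longrightarrow> cmod x \<le> B"
    using finite_imp_bounded[OF assms(1)] unfolding bounded_pos by blast
  define \<alpha> where "\<alpha> = C + B"
  define M where "M = schroedinger_mat c \<gamma> b"
  define Ms where "Ms = (\<lambda>m. schroedinger_mat c \<gamma> (bs m))"
  have M: "bounded_by \<alpha> M"
    unfolding M_def \<alpha>_def by (rule bounded_by_schroedinger_mat) (use C B assms(5) in auto)
  have Ms: "bounded_by \<alpha> (Ms m)" if "1 \<le> m" for m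
    unfolding Ms_def \<alpha>_def by (rule bounded_by_schroedinger_mat) (use C B assms(6) that in auto)
  have TM: "Hplus L \<gamma> b x = band_app w M x" and TMs: "Hplus L \<gamma> (bs m) x = band_app w (Ms m) x"
    if "x \<in> l2N" for x m using T[OF that] by (auto simp: M_def Ms_def)
  have res1: "resolvent_norm (Hplus L \<gamma> b) z = inverse (ereal (lower_modulus w (mat_sub M z)))" for z
    by (rule resolvent_norm_eq_lower_modulus(1)[OF w M TM])
  have res2: "z \<in> spectrumN (Hplus L \<gamma> b) \<longleftrightarrow> lower_modulus w (mat_sub M z) = 0" for z
    by (rule resolvent_norm_eq_lower_modulus(2)[OF w M TM])
  have res3: "z \<in> pseudospectrumN (Hplus L \<gamma> b) \<epsilon> \<longleftrightarrow> lower_modulus w (mat_sub M z) < \<epsilon>" if "0 < \<epsilon>" for z \<epsilon>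
    by (rule resolvent_norm_eq_lower_modulus(3)[OF w M TM that])
  have ress1: "resolvent_norm (Hplus L \<gamma> (bs m)) z = inverse (ereal (lower_modulus w (mat_sub (Ms m) z)))" if "1 \<le> m" for z m
    by (rule resolvent_norm_eq_lower_modulus(1)[OF w Ms[OF that] TMs])
  have ress2: "z \<in> spectrumN (Hplus L \<gamma> (bs m)) \<longleftrightarrow> lower_modulus w (mat_sub (Ms m) z) = 0" if "1 \<le> m" for z m
    by (rule resolvent_norm_eq_lower_modulus(2)[OF w Ms[OF that] TMs])
  have ress3: "z \<in> pseudospectrumN (Hplus L \<gamma> (bs m)) \<epsilon> \<longleftrightarrow> lower_modulus w (mat_sub (Ms m) z) < \<epsilon>" if "1 \<le> m" "0 < \<epsilon>" for z \<epsilon> m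
    by (rule resolvent_norm_eq_lower_modulus(3)[OF w Ms[OF that(1)] TMs that(2)])
  \<comment> \<open>Letters of a finite alphabet are isolated, so pointwise convergence means
    eventual equality. The sequence \<open>bs 0\<close> is unconstrained, hence the restriction to
    \<open>1 \<le> m\<close>.\<close>
  have agree: "eventually (\<lambda>m. bs m n = b n) sequentially" if n: "1 \<le> n" for n
  proof -
    have "(\<lambda>m. bs m n) \<longlonglongrightarrow> b n" using assms(8) n by blast
    moreover have "open (- (Alph - {b n}))" using assms(1) by (intro open_Compl finite_imp_closed) auto
    moreover have "b n \<in> - (Alph - {b n})" by simp
    ultimately have "eventually (\<lambda>m. bs m n \<in> - (Alph - {b n})) sequentially"
      by (rule topological_tendstoD)
    then show ?thesis
      using eventually_ge_at_top[of 1] by eventually_elim (use assms(6) n in auto)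
  qed
  have unif: "eventually (\<lambda>m. 1 \<le> m \<and> (\<forall>z. \<bar>lower_modulus w (mat_sub (Ms m) z) - lower_modulus w (mat_sub M z)\<bar> \<le> e)) sequentially"
    if "0 < e" for e
    unfolding M_def Ms_def
    by (intro eventually_conj eventually_ge_at_top
        lower_modulus_schroedinger_mat_uniform[OF w M[unfolded M_def] Ms[unfolded Ms_def] assms(7) agree that])
  have "(\<lambda>m. resolvent_norm (Hplus L \<gamma> (bs m)) z) \<longlonglongrightarrow> resolvent_norm (Hplus L \<gamma> b) z" for z
  proof -
    have "(\<lambda>m. lower_modulus w (mat_sub (Ms m) z)) \<longlonglongrightarrow> lower_modulus w (mat_sub M z)"
    proof (rule tendstoI)
      fix e :: real assume "0 < e"
      then have "0 < e / 2" by simp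
      from unif[OF this] show "eventually (\<lambda>m. dist (lower_modulus w (mat_sub (Ms m) z)) (lower_modulus w (mat_sub M z)) < e) sequentially"
      proof eventually_elim
        case (elim m)
        then have "\<bar>lower_modulus w (mat_sub (Ms m) z) - lower_modulus w (mat_sub M z)\<bar> \<le> e / 2" by blast
        then show ?case using \<open>0 < e\<close> by (simp add: dist_real_def)
      qed
    qed
    then have "(\<lambda>m. ereal (lower_modulus w (mat_sub (Ms m) z))) \<longlonglongrightarrow> ereal (lower_modulus w (mat_sub M z))" by simp
    \<comment> \<open>Inversion is continuous on the nonnegative extended reals, also at 0 where its
      value is infinite; this covers the points of the spectrum of the limit operator.\<close>
    then have "(\<lambda>m. inverse (ereal (lower_modulus w (mat_sub (Ms m) z)))) \<longlonglongrightarrow> inverse (ereal (lower_modulus w (mat_sub M z)))"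
    proof (rule continuous_on_tendsto_compose[OF continuous_on_inverse_ereal])
      show "ereal (lower_modulus w (mat_sub M z)) \<in> {0..}" using lower_modulus_nonneg[OF w bounded_by_mat_sub[OF M]] by simp
      show "eventually (\<lambda>m. ereal (lower_modulus w (mat_sub (Ms m) z)) \<in> {0..}) sequentially"
        using eventually_ge_at_top[of 1]
        by eventually_elim (use lower_modulus_nonneg[OF w bounded_by_mat_sub[OF Ms]] in auto)
    qed
    then show ?thesis
      unfolding res1
      by (rule Lim_transform_eventually)
        (use eventually_ge_at_top[of 1] in \<open>eventually_elim, simp add: ress1\<close>)
  qed
  moreover have "(\<lambda>m. hausdistE (pseudospectrumN (Hplus L \<gamma> (bs m)) \<epsilon>)
      (pseudospectrumN (Hplus L \<gamma> b) \<epsilon>)) \<longlonglongrightarrow> 0" if \<epsilon>: "0 < \<epsilon>" for \<epsilon>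
  proof (rule hausdistE_tendsto_0)
    fix \<eta> :: real assume \<eta>: "0 < \<eta>"
    obtain \<delta> where \<delta>: "0 < \<delta>"
      and near: "\<And>M z. bounded_by \<alpha> M \<Longrightarrow> lower_modulus w (mat_sub M z) < \<epsilon> + \<delta>
        \<Longrightarrow> \<exists>z'. dist z' z \<le> \<eta> \<and> lower_modulus w (mat_sub M z') < \<epsilon>"
      using lower_bound_pseudospectrum[OF w bounded_by_nonneg[OF M] \<epsilon> \<eta>] by blast
    \<comment> \<open>Once the moduli are \<open>\<delta> / 2\<close>-close, a point of one
      pseudospectrum has modulus below \<open>\<epsilon> + \<delta>\<close> for the other matrix,
      and \<open>near\<close> moves it by at most \<open>\<eta>\<close>.\<close>
    have "0 < \<delta> / 2" using \<delta> by simp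
    from unif[OF this]
    show "eventually (\<lambda>m. (\<forall>x\<in>pseudospectrumN (Hplus L \<gamma> (bs m)) \<epsilon>.
          \<exists>y\<in>pseudospectrumN (Hplus L \<gamma> b) \<epsilon>. dist x y \<le> \<eta>) \<and>
        (\<forall>y\<in>pseudospectrumN (Hplus L \<gamma> b) \<epsilon>.
          \<exists>x\<in>pseudospectrumN (Hplus L \<gamma> (bs m)) \<epsilon>. dist y x \<le> \<eta>)) sequentially"
    proof eventually_elim
      case (elim m)
      then have m: "1 \<le> m"
        and close: "\<And>z. \<bar>lower_modulus w (mat_sub (Ms m) z) - lower_modulus w (mat_sub M z)\<bar> \<le> \<delta> / 2" by auto
      have "\<exists>y. lower_modulus w (mat_sub M y) < \<epsilon> \<and> dist x y \<le> \<eta>" if "lower_modulus w (mat_sub (Ms m) x) < \<epsilon>" for x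
        using near[OF M, of x] that close[of x] \<delta> by (fastforce simp: dist_commute)
      moreover have "\<exists>x. lower_modulus w (mat_sub (Ms m) x) < \<epsilon> \<and> dist y x \<le> \<eta>" if "lower_modulus w (mat_sub M y) < \<epsilon>" for y
        using near[OF Ms[OF m], of y] that close[of y] \<delta> by (fastforce simp: dist_commute)
      ultimately show ?case
        unfolding Ball_def Bex_def res3[OF \<epsilon>] ress3[OF m \<epsilon>] by blast
    qed
  qed
  moreover have "(\<lambda>m. hausdistE (spectrumN (Hplus L \<gamma> (bs m))) (spectrumN (Hplus L \<gamma> b))) \<longlonglongrightarrow> 0"
    if norm: "\<forall>m\<ge>1. normalN (Hplus L \<gamma> (bs m))" "normalN (Hplus L \<gamma> b)"
  proof (rule hausdistE_tendsto_0)
    fix \<eta> :: real assume \<eta>: "0 < \<eta>"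
    have nM: "normal_matrix w M" by (rule normalN_band_app[OF M w TM norm(2)])
    \<comment> \<open>A point of one spectrum has modulus at most \<open>\<eta> / 50\<close> for the
      other matrix; the factor 50 in \<open>normal_matrix_spectrum_near\<close> turns this into the
      distance \<open>\<eta>\<close>.\<close>
    have "0 < \<eta> / 50" using \<eta> by simp
    from unif[OF this]
    show "eventually (\<lambda>m. (\<forall>x\<in>spectrumN (Hplus L \<gamma> (bs m)). \<exists>y\<in>spectrumN (Hplus L \<gamma> b). dist x y \<le> \<eta>) \<and>
        (\<forall>y\<in>spectrumN (Hplus L \<gamma> b). \<exists>x\<in>spectrumN (Hplus L \<gamma> (bs m)). dist y x \<le> \<eta>)) sequentially"
    proof eventually_elim
      case (elim m)
      then have m: "1 \<le> m"
        and close: "\<And>z. \<bar>lower_modulus w (mat_sub (Ms m) z) - lower_modulus w (mat_sub M z)\<bar> \<le> \<eta> / 50" by auto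
      have nMs: "normal_matrix w (Ms m)"
        by (rule normalN_band_app[OF Ms[OF m] w TMs]) (use norm(1) m in auto)
      have "\<exists>y. lower_modulus w (mat_sub M y) = 0 \<and> dist x y \<le> \<eta>" if "lower_modulus w (mat_sub (Ms m) x) = 0" for x
        using normal_matrix_spectrum_near[OF w M nM, of x] that close[of x]
        by (fastforce simp: dist_commute)
      moreover have "\<exists>x. lower_modulus w (mat_sub (Ms m) x) = 0 \<and> dist y x \<le> \<eta>" if "lower_modulus w (mat_sub M y) = 0" for y
        using normal_matrix_spectrum_near[OF w Ms[OF m] nMs, of y] that close[of y]
        by (fastforce simp: dist_commute)
      ultimately show ?case
        unfolding Ball_def Bex_def res2 ress2[OF m] by blast
    qed
  qed
  ultimately show ?thesis by blast
qed

end
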